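(* Let $G$ be a strongly co-Hopfian abelian group with torsion subgroup $T$. Then $G$ is uniformly strongly co-Hopfian if and only if $T$ is strongly co-Hopfian.
   Context: All groups are abelian. A group $G$ is strongly co-Hopfian if for every endomorphism $f$ of $G$ there is $n\in\mathbb N$ with $f^n(G)=f^{n+1}(G)$. It is uniformly strongly co-Hopfian if there is a fixed $m\in\mathbb N$ such that $\phi^m(G)=\phi^{m+1}(G)$ for every endomorphism $\phi$ of $G$. *)

theory Defs imports Main begin

text \<open>An abelian group is modelled by a type of class ab_group_add; subgroups by subsets.
An endomorphism of a subgroup S is a map sending S into S, additive on S.\<close>

definition endo_on :: "'a::ab_group_add set \<Rightarrow> ('a \<Rightarrow> 'a) \<Rightarrow> bool" where
  "endo_on S f \<longleftrightarrow> f ` S \<subseteq> S \<and> (\<forall>x\<in>S. \<forall>y\<in>S. f (x + y) = f x + f y)"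

definition strongly_coHopfian :: "'a::ab_group_add set \<Rightarrow> bool" where
  "strongly_coHopfian S \<longleftrightarrow>
     (\<forall>f. endo_on S f \<longrightarrow> (\<exists>n::nat. (f ^^ n) ` S = (f ^^ Suc n) ` S))"

definition uniformly_strongly_coHopfian :: "'a::ab_group_add set \<Rightarrow> bool" where
  "uniformly_strongly_coHopfian S \<longleftrightarrow>
     (\<exists>m::nat. \<forall>f. endo_on S f \<longrightarrow> (f ^^ m) ` S = (f ^^ Suc m) ` S)"

definition torsion_subgroup :: "'a::ab_group_add set" where
  "torsion_subgroup = {x. \<exists>n::nat. n > 0 \<and> (\<Sum>i<n. x) = 0}"

end

theory Submission
  imports Defs Complex_Main "HOL-Library.Product_Plus" "HOL-Computational_Algebra.Primes"
begin

text \<open>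
  Multiplication by a prime p shows that the subgroups p^k G become stationary. Hence the p-part
  T_p of T is a direct summand of G, the sum of a divisible group and a group of bounded exponent.
  The p-socle of G is finite: otherwise G contains an infinite independent sequence in a divisible
  subgroup or spanning a bounded direct summand, and shifting it is an endomorphism whose images
  never become stationary. It follows that every T_p is uniformly strongly co-Hopfian.

  If G is uniformly strongly co-Hopfian, an endomorphism of T restricted to T_p extends to G, so
  the bound for G works for all T_p at once and hence for T. Conversely, if T is strongly
  co-Hopfian, gluing the slowest endomorphisms of all the T_p shows that the bounds for the T_p are
  bounded by some m. Let U be the intersection of all p^k G; it is divisible and, by the shift
  argument, of finite torsion-free rank N. An endomorphism f has images stationary from m on in
  T, from N on in (U + T)/T, and from m on in G/U: the last because G/p^k G is finite and f is
  therefore injective on the m-th image in it. Altogether 2m + N works for G.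
\<close>

section \<open>Abelian groups as modules over the integers\<close>

text \<open>The hypothesis gives each endomorphism its own stationary index; uniformity has to come
  from finiteness, and the finiteness of the socles and of the rank of U rests on one contradiction.
  A shift of an independent sequence is easy to define on its span; the obstacle is to define it on
  all of G without making its images stationary. It is made zero on a subgroup H maximal among those
  meeting the span trivially. The span is then essential modulo H, and this alone keeps f^n (x 0)
  out of f^(n+1) (G). From H + span to G there are two ways: a divisible target, or a span so pure
  that H + span is already G. Hence the socle is treated along the chain of the p^k G.

  T itself need not be a summand of G (take the product of all Z/p), so endomorphisms pass between T
  and G one prime at a time. For G/U the index i of f itself is used although it depends on f: it
  yields one candidate preimage for all primes at once, and f^i is afterwards cancelled in each
  G/p^n G.\<close>

definition zmult :: "int \<Rightarrow> 'a::ab_group_add \<Rightarrow> 'a"  (infixr "\<cdot>" 75) where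
  "k \<cdot> x = (if 0 \<le> k then (\<Sum>i<nat k. x) else - (\<Sum>i<nat (- k). x))"

lemma zmult_zero_left: "0 \<cdot> x = 0"
  by (simp add: zmult_def)

lemma zmult_of_nat: "int n \<cdot> x = (\<Sum>i<n. x)"
  by (simp add: zmult_def)

lemma zmult_one: "1 \<cdot> x = x"
  using zmult_of_nat[of 1 x] by simp

lemma zmult_plus_one: "(k + 1) \<cdot> x = k \<cdot> x + x"
proof (cases "0 \<le> k")
  case True
  then have "k + 1 = int (Suc (nat k))" "k = int (nat k)" by auto
  then show ?thesis by (metis zmult_of_nat sum.lessThan_Suc)
next
  case False
  define m where "m = nat (- k) - 1"
  have "k = - int (Suc m)" using False unfolding m_def by auto
  then show ?thesis by (simp add: zmult_def nat_add_distrib)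
qed

lemma zmult_add_left: "(j + k) \<cdot> x = j \<cdot> x + k \<cdot> x"
proof (induction k rule: int_induct[where k = 0])
  case base then show ?case by (simp add: zmult_zero_left)
next
  case (step1 i)
  then show ?case using zmult_plus_one[of "j + i" x] zmult_plus_one[of i x] by (simp add: algebra_simps)
next
  case (step2 i)
  then show ?case using zmult_plus_one[of "j + (i - 1)" x] zmult_plus_one[of "i - 1" x]
    by (simp add: algebra_simps)
qed

lemma zmult_add_right: "k \<cdot> (x + y) = k \<cdot> x + k \<cdot> y"
  by (simp add: zmult_def sum.distrib)

lemma zmult_assoc: "j \<cdot> k \<cdot> x = (j * k) \<cdot> x"
proof (induction j rule: int_induct[where k = 0])
  case base then show ?case by (simp add: zmult_zero_left)
next
  case (step1 i)
  then show ?case using zmult_plus_one[of i "k \<cdot> x"]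
    by (simp add: zmult_add_left[symmetric] algebra_simps)
next
  case (step2 i)
  have "i \<cdot> k \<cdot> x = (i - 1) \<cdot> k \<cdot> x + k \<cdot> x"
    using zmult_plus_one[of "i - 1" "k \<cdot> x"] by simp
  moreover have "(i * k) \<cdot> x = ((i - 1) * k) \<cdot> x + k \<cdot> x"
    by (simp add: zmult_add_left[symmetric] algebra_simps)
  ultimately show ?case using step2 by simp
qed

interpretation Z: module "zmult :: int \<Rightarrow> 'a \<Rightarrow> 'a::ab_group_add"
  by unfold_locales (simp_all add: zmult_add_left zmult_add_right zmult_assoc zmult_one)

text \<open>Over the integers every subgroup is a submodule: closure under \<open>\<cdot>\<close>
  follows by repeated addition.\<close>

lemma subspaceI:
  assumes "0 \<in> S" "\<And>x y. x \<in> S \<Longrightarrow> y \<in> S \<Longrightarrow> x + y \<in> S" "\<And>x. x \<in> S \<Longrightarrow> - x \<in> S"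
  shows "Z.subspace S"
proof (rule Z.subspaceI)
  fix c x assume x: "x \<in> S"
  have "(\<Sum>i<n. x) \<in> S" for n :: nat by (induction n) (use assms x in auto)
  then show "c \<cdot> x \<in> S" using assms(3) by (simp add: zmult_def)
qed (use assms in auto)

lemma zmult_Pair: "k \<cdot> (x, y) = (k \<cdot> x, k \<cdot> y)"
proof -
  have "(\<Sum>i<n. (x, y)) = (\<Sum>i<n. x, \<Sum>i<n. y)" for n :: nat
    by (induction n) (auto simp: zero_prod_def)
  then show ?thesis by (simp add: zmult_def)
qed

abbreviation endo :: "('a::ab_group_add \<Rightarrow> 'a) \<Rightarrow> bool" where
  "endo \<equiv> endo_on UNIV"

lemma endo_add: "endo f \<Longrightarrow> f (x + y) = f x + f y"
  by (simp add: endo_on_def)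

lemma endoI: "(\<And>x y. f (x + y) = f x + f y) \<Longrightarrow> endo f"
  by (simp add: endo_on_def)

lemma endo_on_funpow:
  assumes "endo_on S f" shows "endo_on S (f ^^ n)"
  by (induction n) (use assms in \<open>auto simp: endo_on_def image_subset_iff\<close>)

lemma endo_on_zero:
  assumes "endo_on S f" "Z.subspace S" shows "f 0 = 0"
  using assms(1) Z.subspace_0[OF assms(2)] unfolding endo_on_def
  by (metis add_cancel_left_left)

lemma endo_on_minus:
  assumes "endo_on S f" "Z.subspace S" "x \<in> S" shows "f (- x) = - f x"
  using assms(1) Z.subspace_neg[OF assms(2,3)] assms(3) endo_on_zero[OF assms(1,2)]
  unfolding endo_on_def by (metis add.right_inverse eq_neg_iff_add_eq_0 add.commute)

lemma endo_on_diff: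
  assumes "endo_on S f" "Z.subspace S" "x \<in> S" "y \<in> S" shows "f (x - y) = f x - f y"
proof -
  have "f (x + - y) = f x + f (- y)"
    using assms Z.subspace_neg[OF assms(2,4)] unfolding endo_on_def by blast
  then show ?thesis using endo_on_minus[OF assms(1,2,4)] by simp
qed

lemma endo_on_zmult:
  assumes "endo_on S f" "Z.subspace S" "x \<in> S" shows "f (k \<cdot> x) = k \<cdot> f x"
proof -
  have "f (\<Sum>i<n. x) = (\<Sum>i<n. f x) \<and> (\<Sum>i<n. x) \<in> S" for n :: nat
  proof (induction n)
    case 0 then show ?case using endo_on_zero[OF assms(1,2)] Z.subspace_0[OF assms(2)] by simp
  next
    case (Suc n)
    then show ?case using assms Z.subspace_add[OF assms(2)] by (auto simp: endo_on_def)
  qed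
  then show ?thesis using endo_on_minus[OF assms(1,2)] by (simp add: zmult_def)
qed

lemmas endo_zero = endo_on_zero[OF _ Z.subspace_UNIV]
lemmas endo_minus = endo_on_minus[OF _ Z.subspace_UNIV UNIV_I]
lemmas endo_diff = endo_on_diff[OF _ Z.subspace_UNIV UNIV_I UNIV_I]
lemmas endo_zmult = endo_on_zmult[OF _ Z.subspace_UNIV UNIV_I]

lemma endo_sum:
  assumes "endo f" shows "f (\<Sum>i\<in>A. g i) = (\<Sum>i\<in>A. f (g i))"
  by (induction A rule: infinite_finite_induct) (simp_all add: endo_zero[OF assms] endo_add[OF assms])

section \<open>Stationary images of iterates\<close>

lemma funpow_image_eq_mono:
  fixes f :: "'b \<Rightarrow> 'b"
  assumes "(f ^^ n) ` S = (f ^^ Suc n) ` S" "n \<le> k"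
  shows "(f ^^ k) ` S = (f ^^ Suc k) ` S"
  using assms(2)
proof (induction k rule: dec_induct)
  case base then show ?case by (rule assms(1))
next
  case (step k)
  have "(f ^^ Suc k) ` S = f ` (f ^^ k) ` S" by (auto simp: image_comp)
  also have "\<dots> = f ` (f ^^ Suc k) ` S" using step by simp
  finally show ?case by (auto simp: image_comp)
qed

lemma funpow_image_antimono:
  fixes f :: "'b \<Rightarrow> 'b"
  assumes "f ` S \<subseteq> S" "n \<le> k"
  shows "(f ^^ k) ` S \<subseteq> (f ^^ n) ` S"
  using assms(2)
proof (induction k rule: dec_induct)
  case (step k)
  have "(f ^^ Suc k) ` S = (f ^^ k) ` f ` S" by (simp add: image_comp funpow_swap1 comp_def)
  also have "\<dots> \<subseteq> (f ^^ k) ` S" using assms(1) by blast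
  finally show ?case using step by blast
qed simp

lemma funpow_image_eqI:
  fixes f :: "'b \<Rightarrow> 'b"
  assumes "f ` S \<subseteq> S" "(f ^^ n) ` S \<subseteq> (f ^^ Suc n) ` S"
  shows "(f ^^ n) ` S = (f ^^ Suc n) ` S"
  by (rule subset_antisym[OF assms(2) funpow_image_antimono[OF assms(1)]]) simp

section \<open>Divisible groups and extension of homomorphisms\<close>

text \<open>Homomorphisms are constructed below as subgroups of the product. Being single-valued at
  0 suffices, because two values at x differ by a value at 0.\<close>

lemma total_relation_endo:
  fixes R :: "('a::ab_group_add \<times> 'a) set"
  assumes R: "Z.subspace R" and sv: "\<And>y. (0, y) \<in> R \<Longrightarrow> y = 0" and tot: "\<And>x. \<exists>y. (x, y) \<in> R"
  obtains f where "endo f" "\<And>x y. (x, y) \<in> R \<longleftrightarrow> y = f x"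
proof -
  obtain f where f: "\<And>x. (x, f x) \<in> R" using tot by metis
  have uniq: "y = f x" if "(x, y) \<in> R" for x y
    using sv[of "y - f x"] Z.subspace_diff[OF R that f[of x]] by simp
  have "endo f"
    using Z.subspace_add[OF R f f] uniq by (intro endoI) (metis add_Pair)
  then show thesis using that f uniq by blast
qed

lemma subspace_chain_Union:
  assumes "subset.chain \<A> \<C>" "\<C> \<noteq> {}" "\<And>S. S \<in> \<A> \<Longrightarrow> Z.subspace S"
  shows "Z.subspace (\<Union>\<C>)"
proof (rule Z.subspaceI)
  have sub: "S \<in> \<C> \<Longrightarrow> Z.subspace S" for S using assms(1,3) by (auto simp: subset_chain_def)
  show "0 \<in> \<Union>\<C>" using assms(2) sub Z.subspace_0 by blast
  show "c \<cdot> x \<in> \<Union>\<C>" if "x \<in> \<Union>\<C>" for c x using that sub Z.subspace_scale by blast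
  fix x y assume "x \<in> \<Union>\<C>" "y \<in> \<Union>\<C>"
  then obtain X Y where XY: "x \<in> X" "X \<in> \<C>" "y \<in> Y" "Y \<in> \<C>" by blast
  then have "X \<subseteq> Y \<or> Y \<subseteq> X" using assms(1) by (auto simp: subset_chain_def)
  then show "x + y \<in> \<Union>\<C>" using XY sub Z.subspace_add by (metis UnionI subsetD)
qed

lemma subspace_adjoin:
  assumes "Z.subspace S" shows "Z.subspace {s + k \<cdot> x | s k. s \<in> S}"
proof (rule subspaceI)
  show "0 \<in> {s + k \<cdot> x | s k. s \<in> S}" using Z.subspace_0[OF assms] by (force intro: exI[of _ 0])
next
  fix a b assume "a \<in> {s + k \<cdot> x | s k. s \<in> S}" "b \<in> {s + k \<cdot> x | s k. s \<in> S}"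
  then obtain s k s' k' where "a = s + k \<cdot> x" "b = s' + k' \<cdot> x" "s \<in> S" "s' \<in> S" by blast
  then have "a + b = (s + s') + (k + k') \<cdot> x \<and> s + s' \<in> S"
    using Z.subspace_add[OF assms] by (simp add: zmult_add_left algebra_simps)
  then show "a + b \<in> {s + k \<cdot> x | s k. s \<in> S}" by blast
next
  fix a assume "a \<in> {s + k \<cdot> x | s k. s \<in> S}"
  then obtain s k where "a = s + k \<cdot> x" "s \<in> S" by blast
  then have "- a = - s + (- k) \<cdot> x \<and> - s \<in> S"
    using Z.subspace_neg[OF assms] by simp
  then show "- a \<in> {s + k \<cdot> x | s k. s \<in> S}" by blast
qed

lemma mem_adjoin:
  assumes "Z.subspace S"
  shows "S \<subseteq> {s + k \<cdot> x | s k. s \<in> S}" "x \<in> {s + k \<cdot> x | s k. s \<in> S}"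
proof -
  show "S \<subseteq> {s + k \<cdot> x | s k. s \<in> S}" by (force intro: exI[of _ 0])
  have "x = 0 + 1 \<cdot> x" by simp
  then show "x \<in> {s + k \<cdot> x | s k. s \<in> S}" using Z.subspace_0[OF assms] by blast
qed

text \<open>Zorn's lemma. The last clause is what maximality gives: adjoining g to H must create a
  nonzero element of W. In other words, the image of W is essential in the quotient by H.\<close>

lemma maximal_disjoint_subspace:
  fixes N W :: "'a::ab_group_add set"
  assumes N: "Z.subspace N" and W: "Z.subspace W" and NW: "N \<inter> W \<subseteq> {0}"
  obtains H where "Z.subspace H" "N \<subseteq> H" "H \<inter> W \<subseteq> {0}"
    "\<And>g. g \<notin> H \<Longrightarrow> \<exists>b h w. h \<in> H \<and> w \<in> W \<and> w \<noteq> 0 \<and> b \<cdot> g + h = w"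
proof -
  define \<A> where "\<A> = {H. Z.subspace H \<and> N \<subseteq> H \<and> H \<inter> W \<subseteq> {0}}"
  have "\<exists>H\<in>\<A>. \<forall>X\<in>\<A>. H \<subseteq> X \<longrightarrow> X = H"
  proof (rule subset_Zorn_nonempty)
    show "\<A> \<noteq> {}" using assms unfolding \<A>_def by blast
    fix \<C> assume C: "\<C> \<noteq> {}" "subset.chain \<A> \<C>"
    have "Z.subspace (\<Union>\<C>)"
      by (rule subspace_chain_Union[OF C(2,1)]) (simp add: \<A>_def)
    moreover have "N \<subseteq> \<Union>\<C>" "\<Union>\<C> \<inter> W \<subseteq> {0}"
      using C unfolding subset_chain_def \<A>_def by blast+
    ultimately show "\<Union>\<C> \<in> \<A>" unfolding \<A>_def by blast
  qed
  then obtain H where H: "H \<in> \<A>" "\<And>X. X \<in> \<A> \<Longrightarrow> H \<subseteq> X \<Longrightarrow> X = H" by blast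
  have sH: "Z.subspace H" "N \<subseteq> H" "H \<inter> W \<subseteq> {0}" using H(1) by (auto simp: \<A>_def)
  have "\<exists>b h w. h \<in> H \<and> w \<in> W \<and> w \<noteq> 0 \<and> b \<cdot> g + h = w" if g: "g \<notin> H" for g
  proof -
    let ?X = "{s + k \<cdot> g | s k. s \<in> H}"
    have "?X \<notin> \<A>" using H(2)[of ?X] mem_adjoin[OF sH(1), of g] g by blast
    then have "\<not> ?X \<inter> W \<subseteq> {0}"
      using subspace_adjoin[OF sH(1), of g] mem_adjoin(1)[OF sH(1), of g] sH(2)
      unfolding \<A>_def by blast
    then show ?thesis by (auto simp: add.commute)
  qed
  then show thesis using that sH by blast
qed

definition divisible :: "'a::ab_group_add set \<Rightarrow> bool" where
  "divisible U \<longleftrightarrow> (\<forall>k u. k \<noteq> 0 \<longrightarrow> u \<in> U \<longrightarrow> (\<exists>v\<in>U. k \<cdot> v = u))"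

lemma int_ideal_principal:
  assumes "Z.subspace (I :: int set)"
  obtains m where "\<And>k. k \<in> I \<longleftrightarrow> m dvd k"
proof (cases "I \<subseteq> {0}")
  case True
  then show thesis using Z.subspace_0[OF assms] by (intro that[of 0]) auto
next
  case False
  have sc: "k \<cdot> l = k * l" for k l :: int
    by (simp add: zmult_def)
  from False obtain a where a: "a \<in> I" "a \<noteq> 0" by blast
  then have "\<exists>n::nat. n > 0 \<and> int n \<in> I"
    using Z.subspace_neg[OF assms, of a] by (intro exI[of _ "nat \<bar>a\<bar>"]) (auto simp: abs_if)
  then have L: "(LEAST n::nat. n > 0 \<and> int n \<in> I) > 0" "int (LEAST n::nat. n > 0 \<and> int n \<in> I) \<in> I"
    by (metis (mono_tags, lifting) LeastI_ex)+
  define n where "n = (LEAST n::nat. n > 0 \<and> int n \<in> I)"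
  have n: "n > 0" "int n \<in> I" using L unfolding n_def by blast+
  show thesis
  proof (rule that[of "int n"], rule iffI)
    fix k assume k: "k \<in> I"
    have "k mod int n = k - (k div int n) * int n" by (simp add: minus_div_mult_eq_mod)
    then have "k mod int n \<in> I"
      using Z.subspace_diff[OF assms k Z.subspace_scale[OF assms n(2), of "k div int n"]] by (simp add: sc)
    moreover have "nat (k mod int n) < n" using n by (simp add: nat_less_iff)
    ultimately have "\<not> nat (k mod int n) > 0" using not_less_Least[of "nat (k mod int n)" "\<lambda>n. n > 0 \<and> int n \<in> I"]
      unfolding n_def[symmetric] by auto
    then have "k mod int n = 0" using n by (simp add: pos_mod_sign order_antisym)
    then show "int n dvd k" by presburger
  next
    fix k assume "int n dvd k"
    then obtain j where "k = j \<cdot> int n" unfolding sc by (metis dvd_def mult.commute)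
    then show "k \<in> I" using Z.subspace_scale[OF assms n(2)] by simp
  qed
qed

text \<open>Baer's criterion over the integers; partial homomorphisms are represented by their graphs.\<close>
lemma extend_into_divisible:
  fixes R0 :: "('a::ab_group_add \<times> 'a) set"
  assumes U: "Z.subspace U" "divisible U"
    and R0: "Z.subspace R0" "\<And>y. (0, y) \<in> R0 \<Longrightarrow> y = 0" "snd ` R0 \<subseteq> U"
  obtains f where "endo f" "range f \<subseteq> U" "\<And>x y. (x, y) \<in> R0 \<Longrightarrow> f x = y"
proof -
  define \<A> where "\<A> = {R :: ('a \<times> 'a) set. Z.subspace R \<and> (\<forall>y. (0, y) \<in> R \<longrightarrow> y = 0) \<and> snd ` R \<subseteq> U \<and> R0 \<subseteq> R}"
  have "\<exists>H\<in>\<A>. \<forall>X\<in>\<A>. H \<subseteq> X \<longrightarrow> X = H"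
  proof (rule subset_Zorn_nonempty)
    show "\<A> \<noteq> {}" using assms unfolding \<A>_def by blast
    fix \<C> assume C: "\<C> \<noteq> {}" "subset.chain \<A> \<C>"
    have "Z.subspace (\<Union>\<C>)"
      by (rule subspace_chain_Union[OF C(2,1)]) (simp add: \<A>_def)
    moreover have C': "\<And>R. R \<in> \<C> \<Longrightarrow> R \<in> \<A>" using C(2) by (auto simp: subset_chain_def)
    have "\<forall>y. (0, y) \<in> \<Union>\<C> \<longrightarrow> y = 0" "snd ` \<Union>\<C> \<subseteq> U" "R0 \<subseteq> \<Union>\<C>"
      using C(1) C' unfolding \<A>_def by (simp, blast, fast, fast)
    ultimately show "\<Union>\<C> \<in> \<A>" unfolding \<A>_def by simp
  qed
  then obtain R where R: "R \<in> \<A>" "\<And>X. X \<in> \<A> \<Longrightarrow> R \<subseteq> X \<Longrightarrow> X = R" by blast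
  have sR: "Z.subspace R" "\<And>y. (0, y) \<in> R \<Longrightarrow> y = 0" "snd ` R \<subseteq> U" "R0 \<subseteq> R"
    using R(1) by (auto simp: \<A>_def)
  have uniq: "y = y'" if "(x, y) \<in> R" "(x, y') \<in> R" for x y y'
    using sR(2)[of "y - y'"] Z.subspace_diff[OF sR(1) that] by simp
  have tot: "\<exists>y. (x, y) \<in> R" for x
  proof -
    \<comment> \<open>The multiples of x on which R is already defined form an ideal. With a
      generator m of it, extending R to x amounts to solving the single equation m v = y0 in U; if m
      = 0, then y0 = 0 and any v will do.\<close>
    define I where "I = {k. \<exists>y. (k \<cdot> x, y) \<in> R}"
    have "Z.subspace I"
    proof (rule subspaceI)
      have "(0, 0) \<in> R" using Z.subspace_0[OF sR(1)] by (simp add: zero_prod_def)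
      then show "0 \<in> I" unfolding I_def by auto
    next
      fix j k assume "j \<in> I" "k \<in> I"
      then obtain y y' where "(j \<cdot> x, y) \<in> R" "(k \<cdot> x, y') \<in> R" unfolding I_def by blast
      from Z.subspace_add[OF sR(1) this] show "j + k \<in> I"
        unfolding I_def by (auto simp: zmult_add_left)
    next
      fix k assume "k \<in> I"
      then obtain y where "(k \<cdot> x, y) \<in> R" unfolding I_def by blast
      from Z.subspace_neg[OF sR(1) this] show "- k \<in> I" unfolding I_def by auto
    qed
    then obtain m where m: "\<And>k. k \<in> I \<longleftrightarrow> m dvd k" by (rule int_ideal_principal) blast
    obtain y0 where y0: "(m \<cdot> x, y0) \<in> R" using m[of m] unfolding I_def by auto
    have "\<exists>v\<in>U. m \<cdot> v = y0"
    proof (cases "m = 0")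
      case True
      then have "y0 = 0" using y0 sR(2) by simp
      then show ?thesis using Z.subspace_0[OF U(1)] True by auto
    next
      case False
      moreover have "y0 \<in> U" using y0 sR(3) by force
      ultimately show ?thesis using U(2) unfolding divisible_def by blast
    qed
    then obtain v where v: "v \<in> U" "m \<cdot> v = y0" by blast
    let ?X = "{s + k \<cdot> (x, v) | s k. s \<in> R}"
    have "?X \<in> \<A>"
    proof -
      \<comment> \<open>A conflict could only arise where k x already lies in the domain; then m
        divides k, and the old value at k x is k v.\<close>
      have "y = 0" if y: "(0, y) \<in> ?X" for y
      proof -
        obtain s k where "s \<in> R" "(0, y) = s + k \<cdot> (x, v)" using y by blast
        then obtain a b where s: "(a, b) \<in> R" "(0, y) = (a, b) + k \<cdot> (x, v)" by (cases s) blast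
        have e: "a = - (k \<cdot> x)" "y = b + k \<cdot> v"
          using s(2) unfolding zmult_Pair add_Pair by (auto simp: eq_neg_iff_add_eq_0)
        have kb: "(k \<cdot> x, - b) \<in> R" using Z.subspace_neg[OF sR(1) s(1)] e by simp
        then have "m dvd k" using m[of k] unfolding I_def by blast
        then obtain j where j: "k = j * m" by (metis dvd_def mult.commute)
        have "(k \<cdot> x, j \<cdot> y0) \<in> R"
          using Z.subspace_scale[OF sR(1) y0, of j] by (simp add: zmult_Pair j)
        then have "- b = j \<cdot> y0" using uniq kb by blast
        also have "\<dots> = k \<cdot> v" using v j by auto
        finally show ?thesis using e(2) by (metis add.right_inverse)
      qed
      moreover have "snd ` ?X \<subseteq> U"
      proof
        fix u assume "u \<in> snd ` ?X"
        then obtain s k where "s \<in> R" "u = snd (s + k \<cdot> (x, v))" by blast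
        then have "u = snd s + k \<cdot> v" "snd s \<in> U" using sR(3) by (auto simp: zmult_Pair)
        then show "u \<in> U" using v(1) Z.subspace_add[OF U(1)] Z.subspace_scale[OF U(1)] by simp
      qed
      moreover have "R0 \<subseteq> ?X" using mem_adjoin(1)[OF sR(1), of "(x, v)"] sR(4) by (rule subset_trans[rotated])
      ultimately show ?thesis
        using subspace_adjoin[OF sR(1), of "(x, v)"] unfolding \<A>_def by simp
    qed
    then have "?X = R" using mem_adjoin(1)[OF sR(1), of "(x, v)"] by (rule R(2))
    then have "(x, v) \<in> R" using mem_adjoin(2)[OF sR(1), of "(x, v)"] by simp
    then show ?thesis ..
  qed
  obtain f where f: "endo f" "\<And>x y. (x, y) \<in> R \<longleftrightarrow> y = f x"
    using total_relation_endo[OF sR(1,2) tot] by metis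
  have "f x \<in> U" for x using f(2)[of x "f x"] sR(3) by force
  moreover have "f x = y" if "(x, y) \<in> R0" for x y using that f(2)[of x y] sR(4) by auto
  ultimately show thesis using that[OF f(1)] by (metis image_subsetI)
qed

section \<open>Shifts of independent sequences\<close>

text \<open>Coefficients from n on are ignored, so the pair (a, n) replaces a finitely supported
  function; combinations of different lengths are compared after padding with zeros.\<close>

definition lin :: "(nat \<Rightarrow> 'a::ab_group_add) \<Rightarrow> (nat \<Rightarrow> int) \<Rightarrow> nat \<Rightarrow> 'a" where
  "lin x a n = (\<Sum>i<n. a i \<cdot> x i)"

text \<open>The members of the sequence all have order d (infinite order if d = 0) and are independent.\<close>
definition indep_seq :: "int \<Rightarrow> (nat \<Rightarrow> 'a::ab_group_add) \<Rightarrow> bool" where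
  "indep_seq d x \<longleftrightarrow> (\<forall>a n. lin x a n = 0 \<longleftrightarrow> (\<forall>i<n. d dvd a i))"

definition seq_span :: "(nat \<Rightarrow> 'a::ab_group_add) \<Rightarrow> 'a set" where
  "seq_span x = {lin x a n | a n. True}"

lemma lin_0 [simp]: "lin x a 0 = 0"
  by (simp add: lin_def)

lemma lin_Suc: "lin x a (Suc n) = lin x a n + a n \<cdot> x n"
  by (simp add: lin_def)

lemma lin_pad: "n \<le> m \<Longrightarrow> lin x a n = lin x (\<lambda>i. if i < n then a i else 0) m"
  unfolding lin_def by (intro sum.mono_neutral_cong_left) auto

lemma lin_add_same: "lin x a n + lin x b n = lin x (\<lambda>i. a i + b i) n"
  by (simp add: lin_def zmult_add_left sum.distrib)

text \<open>The witnesses do not depend on x. This matters for \<open>shift_graph\<close>, where the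
  same coefficients must serve both x and \<open>x \<circ> Suc\<close>.\<close>

lemma lin_add: "\<exists>c k. \<forall>x::nat \<Rightarrow> 'a::ab_group_add. lin x a m + lin x b n = lin x c k"
proof (intro exI allI)
  fix x :: "nat \<Rightarrow> 'a"
  show "lin x a m + lin x b n
      = lin x (\<lambda>i. (if i < m then a i else 0) + (if i < n then b i else 0)) (max m n)"
    using lin_pad[of m "max m n" x a] lin_pad[of n "max m n" x b] by (simp add: lin_add_same)
qed

lemma lin_zmult: "k \<cdot> lin x a n = lin x (\<lambda>i. k * a i) n"
  by (simp add: lin_def Z.scale_sum_right)

lemma lin_minus: "- lin x a n = lin x (\<lambda>i. - a i) n"
  by (simp add: lin_def sum_negf)

lemma lin_shift: "lin x (case_nat b a) (Suc n) = b \<cdot> x 0 + lin (x \<circ> Suc) a n"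
  unfolding lin_def by (simp add: sum.lessThan_Suc_shift del: sum.lessThan_Suc)

lemma subspace_seq_span: "Z.subspace (seq_span x)"
proof (rule subspaceI)
  show "0 \<in> seq_span x" unfolding seq_span_def by (auto intro!: exI[of _ 0])
  show "u + v \<in> seq_span x" if uv: "u \<in> seq_span x" "v \<in> seq_span x" for u v
  proof -
    obtain a m b n where "u = lin x a m" "v = lin x b n" using uv unfolding seq_span_def by blast
    then show ?thesis using lin_add[of a m b n] unfolding seq_span_def by auto
  qed
  show "- u \<in> seq_span x" if "u \<in> seq_span x" for u
    using that unfolding seq_span_def by (auto simp: lin_minus; blast)
qed

lemma lin_in_seq_span: "lin x a n \<in> seq_span x"
  unfolding seq_span_def by blast

lemma lin_in_subspace:
  assumes "Z.subspace S" "\<And>i. i < n \<Longrightarrow> x i \<in> S" shows "lin x a n \<in> S"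
  unfolding lin_def using assms by (intro Z.subspace_sum Z.subspace_scale) auto

lemma indep_seqD: "indep_seq d x \<Longrightarrow> lin x a n = 0 \<Longrightarrow> i < n \<Longrightarrow> d dvd a i"
  unfolding indep_seq_def by blast

text \<open>Both sides say that d divides all coefficients, because all members have the same order.
  One direction makes the shift well defined on the span, the other makes it injective
  there.\<close>

lemma indep_seq_shift:
  assumes "indep_seq d x"
  shows "lin (x \<circ> Suc) a n = 0 \<longleftrightarrow> lin x a n = 0"
proof -
  have "lin (x \<circ> Suc) a n = lin x (case_nat 0 a) (Suc n)" by (simp add: lin_shift)
  then have "lin (x \<circ> Suc) a n = 0 \<longleftrightarrow> (\<forall>i<Suc n. d dvd case_nat 0 a i)"
    using assms unfolding indep_seq_def by simp
  also have "\<dots> \<longleftrightarrow> (\<forall>i<n. d dvd a i)" by (auto simp: All_less_Suc2)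
  finally show ?thesis using assms unfolding indep_seq_def by simp
qed

text \<open>The graph of the map on the sum of H and the span of x that kills H and sends each x i to
  x (i + 1).\<close>
definition shift_graph :: "'a::ab_group_add set \<Rightarrow> (nat \<Rightarrow> 'a) \<Rightarrow> ('a \<times> 'a) set" where
  "shift_graph H x = {(h + lin x a n, lin (x \<circ> Suc) a n) | h a n. h \<in> H}"

lemma subspace_shift_graph:
  assumes H: "Z.subspace H" shows "Z.subspace (shift_graph H x)"
proof (rule subspaceI)
  show "0 \<in> shift_graph H x"
    unfolding shift_graph_def zero_prod_def using Z.subspace_0[OF H] by (force intro!: exI[of _ "0::nat"])
next
  fix u v assume "u \<in> shift_graph H x" "v \<in> shift_graph H x"
  then obtain h a n h' b m where *: "h \<in> H" "h' \<in> H"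
    "u = (h + lin x a n, lin (x \<circ> Suc) a n)" "v = (h' + lin x b m, lin (x \<circ> Suc) b m)"
    unfolding shift_graph_def by blast
  obtain c k where c: "\<And>y::nat \<Rightarrow> 'a. lin y a n + lin y b m = lin y c k" using lin_add by blast
  have "u + v = ((h + h') + lin x c k, lin (x \<circ> Suc) c k)"
    unfolding c[symmetric] using * by (simp add: algebra_simps)
  then show "u + v \<in> shift_graph H x"
    unfolding shift_graph_def using Z.subspace_add[OF H *(1,2)] by blast
next
  fix u assume "u \<in> shift_graph H x"
  then obtain h a n where *: "h \<in> H" "u = (h + lin x a n, lin (x \<circ> Suc) a n)"
    unfolding shift_graph_def by blast
  then have "- u = (- h + lin x (\<lambda>i. - a i) n, lin (x \<circ> Suc) (\<lambda>i. - a i) n)"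
    by (simp add: lin_minus[symmetric])
  then show "- u \<in> shift_graph H x"
    unfolding shift_graph_def using Z.subspace_neg[OF H *(1)] by blast
qed

lemma shift_graph_single_valued:
  assumes H: "Z.subspace H" and disj: "H \<inter> seq_span x \<subseteq> {0}" and x: "indep_seq d x"
    and y: "(0, y) \<in> shift_graph H x"
  shows "y = 0"
proof -
  obtain h a n where *: "h \<in> H" "h + lin x a n = 0" "y = lin (x \<circ> Suc) a n"
    using y unfolding shift_graph_def by force
  have "lin x a n = - h" using *(2) by (metis eq_neg_iff_add_eq_0 add.commute)
  then have "lin x a n \<in> H" using Z.subspace_neg[OF H *(1)] by simp
  then have "lin x a n = 0" using disj lin_in_seq_span by blast
  then show ?thesis using indep_seq_shift[OF x] * by simp
qed

text \<open>Modulo H the map f is injective: if f g lay in H for some g outside H, then by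
  \<open>max\<close> a multiple of g would be a nonzero w of the span modulo H, and its shift,
  nonzero as well, would lie in H. So if f^n (x 0) = f^(n+1) g, then x 0 - f g lies in H. Applying
  \<open>max\<close> to this g and comparing coefficients gives a contradiction, since the shift
  never reaches place 0.\<close>

lemma shift_not_stable:
  fixes f :: "'a::ab_group_add \<Rightarrow> 'a"
  assumes H: "Z.subspace H" and disj: "H \<inter> seq_span x \<subseteq> {0}"
    and max: "\<And>g. g \<notin> H \<Longrightarrow> \<exists>b h w. h \<in> H \<and> w \<in> seq_span x \<and> w \<noteq> 0 \<and> b \<cdot> g + h = w"
    and x: "indep_seq d x" and d: "\<not> d dvd 1"
    and f: "endo f" "\<And>u v. (u, v) \<in> shift_graph H x \<Longrightarrow> f u = v"
  shows "(f ^^ n) ` UNIV \<noteq> (f ^^ Suc n) ` UNIV"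
proof
  have fH: "f h = 0" if "h \<in> H" for h
  proof -
    have "(h, 0) \<in> shift_graph H x"
      unfolding shift_graph_def using that by (force intro!: exI[of _ "0::nat"])
    then show ?thesis by (rule f(2))
  qed
  have flin: "f (lin x a n) = lin (x \<circ> Suc) a n" for a n
    using Z.subspace_0[OF H] by (intro f(2)) (force simp: shift_graph_def)
  have zero: "y = 0" if "y \<in> H" "y \<in> seq_span x" for y using that disj by blast
  have shift_in: "lin (x \<circ> Suc) a n \<in> seq_span x" for a n
    using lin_in_seq_span[of x "case_nat 0 a" "Suc n"] by (simp add: lin_shift)
  have inj1: "g \<in> H" if fg: "f g \<in> H" for g
  proof (rule ccontr)
    assume "g \<notin> H"
    then obtain b h a n where *: "h \<in> H" "lin x a n \<noteq> 0" "b \<cdot> g + h = lin x a n"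
      using max unfolding seq_span_def by blast
    have "lin (x \<circ> Suc) a n = b \<cdot> f g"
      using fH[OF *(1)] flin[of a n] unfolding *(3)[symmetric] endo_add[OF f(1)] endo_zmult[OF f(1)] by simp
    then have "lin (x \<circ> Suc) a n \<in> H" using Z.subspace_scale[OF H fg] by simp
    then show False using zero shift_in indep_seq_shift[OF x] *(2) by blast
  qed
  have inj: "g \<in> H" if "(f ^^ n) g \<in> H" for g n
    using that by (induction n) (auto dest: inj1)
  assume "(f ^^ n) ` UNIV = (f ^^ Suc n) ` UNIV"
  then obtain g where "(f ^^ n) (x 0) = (f ^^ Suc n) g" by blast
  then have "(f ^^ n) (x 0 - f g) = 0"
    using endo_diff[OF endo_on_funpow[OF f(1)], of n "x 0" "f g"] by (simp add: funpow_swap1)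
  then have xg: "x 0 - f g \<in> H" using inj[of n "x 0 - f g"] Z.subspace_0[OF H] by simp
  show False
  proof (cases "g \<in> H")
    case True
    have x0: "x 0 = lin x (\<lambda>_. 1) 1" by (simp add: lin_def)
    have "x 0 \<in> H" using xg fH[OF True] by simp
    then have "lin x (\<lambda>_. 1) 1 = 0" using zero lin_in_seq_span x0 by metis
    then show False using indep_seqD[OF x, of "\<lambda>_. 1" 1 0] d by simp
  next
    case False
    then obtain b h a n where *: "h \<in> H" "lin x a n \<noteq> 0" "b \<cdot> g + h = lin x a n"
      using max unfolding seq_span_def by blast
    have "lin (x \<circ> Suc) a n = b \<cdot> f g"
      using fH[OF *(1)] flin[of a n] unfolding *(3)[symmetric] endo_add[OF f(1)] endo_zmult[OF f(1)] by simp
    \<comment> \<open>Coefficient b sits at place 0 and the negated coefficients of w one place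
      higher. The combination lies in H and in the span, so it vanishes; then d divides every
      \<open>a i\<close>, and w = 0.\<close>
    then have "b \<cdot> (x 0 - f g) = lin x (case_nat b (\<lambda>i. - a i)) (Suc n)"
      by (simp add: lin_shift lin_minus[symmetric] Z.scale_right_diff_distrib)
    then have "lin x (case_nat b (\<lambda>i. - a i)) (Suc n) = 0"
      using zero lin_in_seq_span Z.subspace_scale[OF H xg, of b] by metis
    then have "d dvd a i" if "i < n" for i
      using indep_seqD[OF x, of _ "Suc n" "Suc i"] that by fastforce
    then show False using x *(2) unfolding indep_seq_def by blast
  qed
qed

text \<open>The shift takes its values in U, so Baer's criterion extends it from H + span to the
  whole group.\<close>

lemma no_indep_seq_in_divisible:
  assumes G: "strongly_coHopfian (UNIV :: 'a::ab_group_add set)"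
    and U: "Z.subspace U" "divisible U" and xU: "\<And>i::nat. (x i :: 'a) \<in> U"
    and x: "indep_seq d x" and d: "\<not> d dvd 1"
  shows False
proof -
  obtain H where H: "Z.subspace H" "H \<inter> seq_span x \<subseteq> {0}"
    "\<And>g. g \<notin> H \<Longrightarrow> \<exists>b h w. h \<in> H \<and> w \<in> seq_span x \<and> w \<noteq> 0 \<and> b \<cdot> g + h = w"
    by (rule maximal_disjoint_subspace[OF Z.subspace_single_0 subspace_seq_span[of x]]) blast+
  have "snd ` shift_graph H x \<subseteq> U"
    using lin_in_subspace[OF U(1)] xU unfolding shift_graph_def by fastforce
  then obtain f where f: "endo f" "\<And>u v. (u, v) \<in> shift_graph H x \<Longrightarrow> f u = v"
    using extend_into_divisible[OF U subspace_shift_graph[OF H(1)] shift_graph_single_valued[OF H(1,2) x]]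
    by (smt (verit))
  obtain n where "(f ^^ n) ` UNIV = (f ^^ Suc n) ` UNIV"
    using G f(1) unfolding strongly_coHopfian_def by blast
  then show ?thesis using shift_not_stable[OF H x d f, of n] by simp
qed

text \<open>Here the shift graph is total from the start. A complement H of the span satisfies the
  maximality clause trivially, with b = 1.\<close>

lemma no_indep_seq_in_summand:
  assumes G: "strongly_coHopfian (UNIV :: 'a::ab_group_add set)"
    and H: "Z.subspace (H :: 'a set)" "H \<inter> seq_span x \<subseteq> {0}" and sum: "\<And>g. \<exists>h\<in>H. \<exists>w\<in>seq_span x. g = h + w"
    and x: "indep_seq d x" and d: "\<not> d dvd 1"
  shows False
proof -
  have max: "\<exists>b h w. h \<in> H \<and> w \<in> seq_span x \<and> w \<noteq> 0 \<and> b \<cdot> g + h = w" if g: "g \<notin> H" for g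
  proof -
    obtain h w where "h \<in> H" "w \<in> seq_span x" "g = h + w" using sum by blast
    moreover then have "w \<noteq> 0" using g by auto
    ultimately show ?thesis using Z.subspace_neg[OF H(1), of h]
      by (intro exI[of _ 1] exI[of _ "- h"] exI[of _ w]) simp
  qed
  have "\<exists>v. (g, v) \<in> shift_graph H x" for g
    using sum[of g] unfolding shift_graph_def seq_span_def by blast
  then obtain f where f: "endo f" "\<And>u v. (u, v) \<in> shift_graph H x \<longleftrightarrow> v = f u"
    using total_relation_endo[OF subspace_shift_graph[OF H(1)] shift_graph_single_valued[OF H(1,2) x]]
    by (smt (verit))
  have f2: "f u = v" if "(u, v) \<in> shift_graph H x" for u v using f(2) that by simp
  obtain n where "(f ^^ n) ` UNIV = (f ^^ Suc n) ` UNIV"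
    using G f(1) unfolding strongly_coHopfian_def by blast
  then show ?thesis using shift_not_stable[OF H max x d f(1) f2, of n] by simp
qed

section \<open>Independent sequences in infinite sets of elements of order p\<close>

lemma finite_adjoin:
  assumes "finite X" "0 < (p::int)" "p \<cdot> w = 0"
  shows "finite {s + k \<cdot> w | s k. s \<in> X}"
proof (rule finite_subset)
  show "{s + k \<cdot> w | s k. s \<in> X} \<subseteq> (\<lambda>(s, k). s + k \<cdot> w) ` (X \<times> {0..<p})"
  proof clarify
    fix s k assume s: "s \<in> X"
    have "k \<cdot> w = (k mod p + (k div p) * p) \<cdot> w" by simp
    also have "\<dots> = (k mod p) \<cdot> w"
      unfolding zmult_add_left zmult_assoc[symmetric] assms(3) by simp
    finally show "s + k \<cdot> w \<in> (\<lambda>(s, k). s + k \<cdot> w) ` (X \<times> {0..<p})"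
      using s assms(2) by (intro image_eqI[of _ _ "(s, k mod p)"]) auto
  qed
qed (use assms in auto)

text \<open>Greedy choice, as in a vector space over the field with p elements: N together with the
  span of finitely many chosen members stays finite, so S has an element outside. Independence
  modulo N, and not only modulo 0, is what \<open>finite_socle_step\<close> uses.\<close>

lemma indep_seq_mod_finite:
  fixes S N :: "'a::ab_group_add set"
  assumes p: "prime (p::int)" and inf: "infinite S" and S: "\<And>s. s \<in> S \<Longrightarrow> p \<cdot> s = 0"
    and N: "Z.subspace N" "finite N"
  obtains w where "\<And>i. w i \<in> S" "\<And>a n i. lin w a n \<in> N \<Longrightarrow> i < n \<Longrightarrow> p dvd a i"
proof -
  define X where "X f n = {\<nu> + lin f a n | \<nu> a. \<nu> \<in> N}" for f :: "nat \<Rightarrow> 'a" and n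
  have "\<exists>w. \<forall>n. w n \<in> S \<and> w n \<notin> X w n"
  proof (rule dependent_wellorder_choice)
    fix r and f g :: "nat \<Rightarrow> 'a" and n :: nat assume "\<And>y. y < n \<Longrightarrow> f y = g y"
    then have "lin f a n = lin g a n" for a unfolding lin_def by simp
    then show "(r \<in> S \<and> r \<notin> X f n) = (r \<in> S \<and> r \<notin> X g n)" unfolding X_def by simp
  next
    fix n :: nat and f :: "nat \<Rightarrow> 'a"
    assume f: "\<And>y. y < n \<Longrightarrow> f y \<in> S \<and> f y \<notin> X f y"
    have "finite (X f m)" if "m \<le> n" for m
      using that
    proof (induction m)
      case 0
      have "X f 0 = N" unfolding X_def by simp
      then show ?case using N by simp
    next
      case (Suc m)
      have "X f (Suc m) \<subseteq> {s + k \<cdot> f m | s k. s \<in> X f m}"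
        unfolding X_def lin_Suc by (force simp: add.assoc[symmetric])
      moreover have "finite {s + k \<cdot> f m | s k. s \<in> X f m}"
        using Suc f[of m] S[of "f m"] prime_gt_0_int[OF p] by (intro finite_adjoin) auto
      ultimately show ?case by (rule finite_subset)
    qed
    then have "infinite (S - X f n)" using inf by simp
    then show "\<exists>r. r \<in> S \<and> r \<notin> X f n" by (metis Diff_iff equals0I finite.emptyI)
  qed
  then obtain w where w: "\<And>n. w n \<in> S" "\<And>n. w n \<notin> X w n" by blast
  have "\<forall>i<n. p dvd a i" if "lin w a n \<in> N" for a n
    using that
  proof (induction n)
    case (Suc n)
    \<comment> \<open>Otherwise \<open>a n\<close> is invertible modulo p, and \<open>w n\<close>
      would lie in N plus the span of the earlier members.\<close>
    have "p dvd a n"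
    proof (rule ccontr)
      assume "\<not> p dvd a n"
      then have "coprime (a n) (p)" using p
        by (metis coprime_commute prime_imp_coprime)
      then obtain c e where ce: "c * a n + e * p = 1" by (metis bezout_int coprime_iff_gcd_eq_1)
      have "w n = (c * a n + e * p) \<cdot> w n" using ce by simp
      also have "\<dots> = c \<cdot> a n \<cdot> w n"
        unfolding zmult_add_left zmult_assoc[symmetric] S[OF w(1)] by simp
      also have "a n \<cdot> w n = lin w a (Suc n) - lin w a n" by (simp add: lin_Suc)
      finally have "w n = c \<cdot> lin w a (Suc n) + lin w (\<lambda>i. - c * a i) n"
        by (simp add: Z.scale_right_diff_distrib lin_zmult lin_minus[symmetric])
      then show False using w(2)[of n] Z.subspace_scale[OF N(1) Suc.prems, of c] unfolding X_def by blast
    qed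
    moreover then obtain e where "a n = e * p" by (metis dvd_def mult.commute)
    then have "a n \<cdot> w n = 0" using S[OF w(1)[of n]] by (simp add: zmult_assoc[symmetric] del: Z.scale_scale)
    ultimately show ?case using Suc by (auto simp: lin_Suc less_Suc_eq)
  qed simp
  then show thesis using that w(1) by blast
qed

section \<open>Finiteness of the socle\<close>

definition primary :: "int \<Rightarrow> 'a::ab_group_add set" where
  "primary p = {x. \<exists>k. p ^ k \<cdot> x = 0}"

abbreviation multiples :: "int \<Rightarrow> 'a::ab_group_add set" where
  "multiples k \<equiv> range (zmult k)"

lemma subspace_multiples: "Z.subspace (multiples k)"
proof (rule subspaceI)
  show "0 \<in> multiples k" using Z.scale_zero_right by (metis rangeI)
  show "x + y \<in> multiples k" if "x \<in> multiples k" "y \<in> multiples k" for x y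
    using that by (auto simp: zmult_add_right[symmetric])
  show "- x \<in> multiples k" if "x \<in> multiples k" for x
    using that by (auto simp: Z.scale_minus_right[symmetric] simp del: Z.scale_minus_right)
qed

lemma subspace_annihilator: "Z.subspace {x. k \<cdot> x = 0}"
  by (rule subspaceI) (auto simp: zmult_add_right)

lemma subspace_primary: "Z.subspace (primary p :: 'a::ab_group_add set)"
proof (rule subspaceI)
  show "(0::'a) \<in> primary p" by (simp add: primary_def)
  show "- x \<in> primary p" if "x \<in> primary p" for x :: 'a using that by (simp add: primary_def)
  fix x y :: 'a assume "x \<in> primary p" "y \<in> primary p"
  then obtain j k where "p ^ j \<cdot> x = 0" "p ^ k \<cdot> y = 0" unfolding primary_def by blast
  moreover have "p ^ (j + k) \<cdot> (x + y) = p ^ k \<cdot> p ^ j \<cdot> x + p ^ j \<cdot> p ^ k \<cdot> y"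
    by (simp add: zmult_add_right power_add mult.commute)
  ultimately show "x + y \<in> primary p" unfolding primary_def by (auto intro!: exI[of _ "j + k"] simp del: Z.scale_scale)
qed

lemma primary_zmult_cancel: "p ^ k \<cdot> x \<in> primary p \<longleftrightarrow> x \<in> primary p"
proof
  assume "p ^ k \<cdot> x \<in> primary p"
  then obtain j where "p ^ j \<cdot> p ^ k \<cdot> x = 0" unfolding primary_def by blast
  then have "p ^ (j + k) \<cdot> x = 0" by (simp add: power_add)
  then show "x \<in> primary p" unfolding primary_def by blast
qed (rule Z.subspace_scale[OF subspace_primary])

lemma bezout_zmult:
  assumes "coprime (a::int) b"
  shows "\<exists>c e. \<forall>x::'a::ab_group_add. x = c \<cdot> a \<cdot> x + e \<cdot> b \<cdot> x"
proof -
  obtain c e where "c * a + e * b = 1" using assms by (metis bezout_int coprime_iff_gcd_eq_1)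
  then have "x = c \<cdot> a \<cdot> x + e \<cdot> b \<cdot> x" for x :: 'a
    using zmult_add_left[of "c * a" "e * b" x] by simp
  then show ?thesis by blast
qed

text \<open>Integers prime to p act invertibly on p-primary elements by Bezout, so division by p is
  the only one to check.\<close>

lemma divisible_primaryI:
  fixes D :: "'a::ab_group_add set"
  assumes p: "prime p" and D: "Z.subspace D" "D \<subseteq> primary p"
    and dv: "\<And>u. u \<in> D \<Longrightarrow> \<exists>v\<in>D. p \<cdot> v = u"
  shows "divisible D"
  unfolding divisible_def
proof (intro allI impI)
  fix k :: int and u assume k: "k \<noteq> 0" and u: "u \<in> D"
  have dvp: "\<exists>v\<in>D. p ^ j \<cdot> v = u" for j
  proof (induction j)
    case 0 then show ?case using u by simp
  next
    case (Suc j)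
    then obtain v where "v \<in> D" "p ^ j \<cdot> v = u" by blast
    moreover then obtain v' where "v' \<in> D" "p \<cdot> v' = v" using dv by blast
    ultimately show ?case by (auto intro!: bexI[of _ v'] simp: mult.commute)
  qed
  have "\<not> is_unit p" using p by auto
  with k obtain m where m: "k = p ^ multiplicity p k * m" "\<not> p dvd m"
    by (rule multiplicity_decompose')
  obtain v where v: "v \<in> D" "p ^ multiplicity p k \<cdot> v = u" using dvp by blast
  obtain t where t: "p ^ t \<cdot> v = 0" using v(1) D(2) unfolding primary_def by blast
  have "coprime m p" using m(2) p by (metis coprime_commute prime_imp_coprime)
  then have "coprime m (p ^ t)" by simp
  then obtain c e where "v = c \<cdot> m \<cdot> v + e \<cdot> p ^ t \<cdot> v" using bezout_zmult by blast
  then have "v = m \<cdot> c \<cdot> v" using t by (simp add: mult.commute del: Z.scale_scale) (simp add: mult.commute)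
  then have "k \<cdot> c \<cdot> v = u" using v(2) m(1)
    by (metis zmult_assoc mult.commute)
  then show "\<exists>v\<in>D. k \<cdot> v = u" using Z.subspace_scale[OF D(1) v(1)] by blast
qed

lemma zmult_funpow: "zmult p ^^ n = zmult (p ^ n)"
  by (induction n) (auto simp: fun_eq_iff)

lemma coHopfian_multiples_stable:
  assumes "strongly_coHopfian (UNIV :: 'a::ab_group_add set)"
  obtains n where "\<And>k. n \<le> k \<Longrightarrow> multiples (p ^ k) = (multiples (p ^ n) :: 'a set)"
proof -
  have "endo (zmult p :: 'a \<Rightarrow> 'a)" by (rule endoI) (rule zmult_add_right)
  then obtain n where n: "(zmult p ^^ n) ` UNIV = ((zmult p ^^ Suc n) ` UNIV :: 'a set)"
    using assms unfolding strongly_coHopfian_def by blast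
  have "multiples (p ^ k) = (multiples (p ^ n) :: 'a set)" if "n \<le> k" for k
    using that
  proof (induction k rule: dec_induct)
    case (step k)
    then show ?case using funpow_image_eq_mono[OF n, of k] unfolding zmult_funpow by simp
  qed simp
  then show thesis by (rule that)
qed

text \<open>An element u of this subgroup is also p^(n+1) y for some y, and y is p-primary because u
  is; hence p^n y is a quotient of u by p inside the subgroup.\<close>

lemma divisible_primary_multiples:
  assumes p: "prime p"
    and n: "\<And>k. n \<le> k \<Longrightarrow> multiples (p ^ k) = (multiples (p ^ n) :: 'a::ab_group_add set)"
  shows "Z.subspace (primary p \<inter> multiples (p ^ n) :: 'a set)" "divisible (primary p \<inter> multiples (p ^ n) :: 'a set)"
proof -
  show s: "Z.subspace (primary p \<inter> multiples (p ^ n) :: 'a set)"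
    by (intro Z.subspace_inter subspace_primary subspace_multiples)
  show "divisible (primary p \<inter> multiples (p ^ n) :: 'a set)"
  proof (rule divisible_primaryI[OF p s])
    fix u :: 'a assume u: "u \<in> primary p \<inter> multiples (p ^ n)"
    then have "u \<in> multiples (p ^ Suc n)" using n[of "Suc n"] by simp
    then obtain y where y: "u = p ^ Suc n \<cdot> y" by blast
    then have "y \<in> primary p" using u primary_zmult_cancel[of p "Suc n" y] by simp
    then show "\<exists>v\<in>primary p \<inter> multiples (p ^ n). p \<cdot> v = u"
      using y primary_zmult_cancel[of p n y] by (intro bexI[of _ "p ^ n \<cdot> y"]) auto
  qed auto
qed

lemma indep_seqI:
  assumes "\<And>a n i. lin x a n = 0 \<Longrightarrow> i < n \<Longrightarrow> d dvd a i" "\<And>i. d \<cdot> x i = 0"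
  shows "indep_seq d x"
  unfolding indep_seq_def
proof (intro allI iffI)
  fix a and n :: nat assume *: "\<forall>i<n. d dvd a i"
  have "a i \<cdot> x i = 0" if i: "i < n" for i
  proof -
    obtain b where "a i = b * d" using * i by (metis dvd_def mult.commute)
    then show ?thesis using assms(2)[of i] by (metis zmult_assoc Z.scale_zero_right)
  qed
  then show "lin x a n = 0" by (simp add: lin_def)
qed (use assms(1) in blast)

lemma finite_socle_divisible:
  assumes G: "strongly_coHopfian (UNIV :: 'a::ab_group_add set)" and p: "prime p"
    and n: "\<And>k. n \<le> k \<Longrightarrow> multiples (p ^ k) = (multiples (p ^ n) :: 'a set)"
  shows "finite ({x. p \<cdot> x = 0} \<inter> multiples (p ^ n) :: 'a set)" (is "finite ?S")
proof (rule ccontr)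
  assume inf: "infinite ?S"
  obtain w where w: "\<And>i. w i \<in> ?S" "\<And>a n i. lin w a n \<in> {0} \<Longrightarrow> i < n \<Longrightarrow> p dvd a i"
    using indep_seq_mod_finite[OF p inf _ Z.subspace_single_0] by auto
  have "indep_seq p w" by (rule indep_seqI) (use w in auto)
  moreover have "w i \<in> primary p \<inter> multiples (p ^ n)" for i
    using w(1)[of i] unfolding primary_def by (auto intro!: exI[of _ 1])
  ultimately show False
    using no_indep_seq_in_divisible[OF G divisible_primary_multiples[OF p n]] p by (metis not_prime_unit)
qed

text \<open>If the socle of p^k G is infinite but that of p^(k+1) G is finite, there is a sequence w
  in the former that is independent modulo the latter. Choose x with p^k x_i = w_i. The x_i are
  independent of order p^(k+1), and their span meets p^(k+1) G trivially. As in the theorem that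
  bounded pure subgroups are summands, a maximal H above p^(k+1) G that meets the span trivially is
  a complement, so the shift on the span contradicts strong co-Hopficity.\<close>

lemma finite_socle_step:
  assumes G: "strongly_coHopfian (UNIV :: 'a::ab_group_add set)" and p: "prime p"
    and fin: "finite ({x. p \<cdot> x = 0} \<inter> multiples (p ^ Suc k) :: 'a set)"
  shows "finite ({x. p \<cdot> x = 0} \<inter> multiples (p ^ k) :: 'a set)" (is "finite ?S")
proof (rule ccontr)
  let ?N = "{x::'a. p \<cdot> x = 0} \<inter> multiples (p ^ Suc k)"
  have p0: "p \<noteq> 0" using p by auto
  assume inf: "infinite ?S"
  have sN: "Z.subspace ?N" by (intro Z.subspace_inter subspace_annihilator subspace_multiples)
  obtain w where w: "\<And>i. w i \<in> ?S" "\<And>a n i. lin w a n \<in> ?N \<Longrightarrow> i < n \<Longrightarrow> p dvd a i"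
    using indep_seq_mod_finite[OF p inf _ sN fin] by auto
  have "\<exists>y. w i = p ^ k \<cdot> y" for i using w(1)[of i] by auto
  then obtain x where x: "\<And>i. w i = p ^ k \<cdot> x i" by metis
  have x0: "p ^ Suc k \<cdot> x i = 0" for i
    using w(1)[of i] x[of i] by simp
  have linw: "lin x (\<lambda>i. p ^ k * b i) m = lin w b m" for b m
    unfolding lin_def x by (simp add: mult.commute)
  \<comment> \<open>One factor p at a time: p^(k-j) times the combination is a combination of the
    w_i with coefficients a_i / p^j; it lies in \<open>?N\<close>, so p divides these too. Assuming
    membership in p^(k+1) G rather than vanishing yields both independence and disjointness.\<close>
  have dvd: "p ^ j dvd a i" if "lin x a m \<in> multiples (p ^ Suc k)" "i < m" "j \<le> Suc k" for a m i j
    using that(2,3)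
  proof (induction j arbitrary: i)
    case (Suc j)
    define b where "b i = a i div p ^ j" for i
    have b: "a i = p ^ j * b i" if "i < m" for i using Suc that unfolding b_def by simp
    have "p ^ (k - j) \<cdot> lin x a m = lin x (\<lambda>i. p ^ (k - j) * (p ^ j * b i)) m"
      unfolding lin_zmult unfolding lin_def using b by simp
    also have "\<dots> = lin w b m"
      unfolding linw[symmetric] using Suc(3) by (simp add: mult.assoc[symmetric] power_add[symmetric])
    finally have "lin w b m \<in> multiples (p ^ Suc k)"
      using Z.subspace_scale[OF subspace_multiples that(1)] by metis
    moreover have "lin w b m \<in> {x. p \<cdot> x = 0}"
      using w(1) by (intro lin_in_subspace subspace_annihilator) auto
    ultimately have "p dvd b i" using w(2) Suc(2) by blast
    then show ?case using b[OF Suc(2)] by (simp add: mult_dvd_mono mult.commute)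
  qed simp
  have ind: "indep_seq (p ^ Suc k) x"
  proof (rule indep_seqI)
    show "p ^ Suc k dvd a i" if "lin x a n = 0" "i < n" for a n i
      using dvd[OF _ that(2) order_refl] that(1) Z.subspace_0[OF subspace_multiples] by metis
  qed (rule x0)
  have "multiples (p ^ Suc k) \<inter> seq_span x \<subseteq> {0}"
  proof
    fix y assume y: "y \<in> multiples (p ^ Suc k) \<inter> seq_span x"
    then obtain a m where a: "y = lin x a m" unfolding seq_span_def by blast
    then have "\<forall>i<m. p ^ Suc k dvd a i" using dvd[OF _ _ order_refl] y by blast
    then show "y \<in> {0}" using ind a unfolding indep_seq_def by blast
  qed
  \<comment> \<open>H is taken above p^(k+1) G so that p^(k+1) g lies in H for every g; the
    induction on j below then reaches all of G.\<close>
  then obtain H where H: "Z.subspace H" "multiples (p ^ Suc k) \<subseteq> H" "H \<inter> seq_span x \<subseteq> {0}"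
    "\<And>g. g \<notin> H \<Longrightarrow> \<exists>b h w. h \<in> H \<and> w \<in> seq_span x \<and> w \<noteq> 0 \<and> b \<cdot> g + h = w"
    by (rule maximal_disjoint_subspace[OF subspace_multiples subspace_seq_span]) blast+
  note sp = subspace_seq_span[of x]
  have "\<exists>h\<in>H. \<exists>v\<in>seq_span x. g = h + v" if "p ^ j \<cdot> g \<in> H" "j \<le> Suc k" for g j
    using that
  proof (induction j arbitrary: g)
    case 0
    then show ?case using Z.subspace_0[OF sp] by (intro bexI[of _ g] bexI[of _ 0]) auto
  next
    case (Suc j)
    define y where "y = p ^ j \<cdot> g"
    have py: "p \<cdot> y \<in> H" using Suc.prems(1) by (simp add: y_def)
    show ?case
    proof (cases "y \<in> H")
      case True
      then show ?thesis using Suc unfolding y_def by simp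
    next
      case False
      then obtain b h v where *: "h \<in> H" "v \<in> seq_span x" "v \<noteq> 0" "b \<cdot> y + h = v" using H(4) by blast
      have "\<not> p dvd b"
      proof
        assume "p dvd b"
        then obtain b' where "b = b' * p" by (metis dvd_def mult.commute)
        then have "b \<cdot> y \<in> H" using Z.subspace_scale[OF H(1) py, of b'] by simp
        then have "v \<in> H" using Z.subspace_add[OF H(1) _ *(1)] *(4) by blast
        then show False using *(2,3) H(3) by blast
      qed
      then have "coprime b p" using p by (metis coprime_commute prime_imp_coprime)
      \<comment> \<open>Bezout turns b y + h = v into y = c v + h' with h' in H. As p c v lies in H
        and in the span, it is 0; so the coefficients of c v are divisible by p^k and c v = p^k c'.
        Subtracting p^(k-j) c' from g brings its p^j-multiple into H.\<close>
      then obtain c e where ce: "y = c \<cdot> b \<cdot> y + e \<cdot> p \<cdot> y" using bezout_zmult by blast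
      define h' where "h' = e \<cdot> p \<cdot> y - c \<cdot> h"
      have h': "h' \<in> H" unfolding h'_def
        by (intro Z.subspace_diff[OF H(1)] Z.subspace_scale[OF H(1)] py *(1))
      have "b \<cdot> y = v - h" using *(4) by (simp add: eq_diff_eq)
      then have y: "y = c \<cdot> v + h'" using ce unfolding h'_def
        by (metis Z.scale_right_diff_distrib add_diff_eq diff_add_eq)
      obtain a m where a: "c \<cdot> v = lin x a m"
        using Z.subspace_scale[OF sp *(2)] unfolding seq_span_def by blast
      have "p \<cdot> c \<cdot> v = p \<cdot> y - p \<cdot> h'" unfolding y by (simp add: zmult_add_right)
      then have "p \<cdot> c \<cdot> v \<in> H" using Z.subspace_diff[OF H(1) py Z.subspace_scale[OF H(1) h']] by simp
      moreover have "p \<cdot> c \<cdot> v \<in> seq_span x" by (intro Z.subspace_scale[OF sp] *(2))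
      ultimately have "p \<cdot> c \<cdot> v = 0" using H(3) by blast
      then have "lin x (\<lambda>i. p * a i) m = 0" using a lin_zmult[of p x a m] by metis
      then have pk: "p ^ k dvd a i" if "i < m" for i
        using indep_seqD[OF ind _ that] p0 by fastforce
      define c' where "c' = lin x (\<lambda>i. a i div p ^ k) m"
      have c': "p ^ k \<cdot> c' = c \<cdot> v"
        unfolding c'_def a lin_zmult unfolding lin_def using pk by simp
      have jk: "p ^ j \<cdot> p ^ (k - j) \<cdot> c' = p ^ k \<cdot> c'"
        using Suc.prems(2) by (simp add: power_add[symmetric])
      have "p ^ j \<cdot> (g - p ^ (k - j) \<cdot> c') = h'"
        unfolding Z.scale_right_diff_distrib jk c' using y unfolding y_def by (simp add: add.commute)
      then obtain h2 v2 where "h2 \<in> H" "v2 \<in> seq_span x" "g - p ^ (k - j) \<cdot> c' = h2 + v2"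
        using Suc.IH[of "g - p ^ (k - j) \<cdot> c'"] Suc.prems(2) h' by auto
      moreover have "v2 + p ^ (k - j) \<cdot> c' \<in> seq_span x"
        unfolding c'_def by (intro Z.subspace_add[OF sp] Z.subspace_scale[OF sp] lin_in_seq_span calculation)
      ultimately show ?thesis by (metis diff_eq_eq add.assoc)
    qed
  qed
  then have "\<exists>h\<in>H. \<exists>v\<in>seq_span x. g = h + v" for g using H(2) by blast
  moreover have "\<not> p ^ Suc k dvd 1" using p by (metis dvd_trans dvd_triv_left not_prime_unit power_Suc)
  ultimately show False using no_indep_seq_in_summand[OF G H(1,3) _ ind] by blast
qed

lemma finite_socle:
  assumes G: "strongly_coHopfian (UNIV :: 'a::ab_group_add set)" and p: "prime p"
  shows "finite {x::'a. p \<cdot> x = 0}"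
proof -
  obtain n where n: "\<And>k. n \<le> k \<Longrightarrow> multiples (p ^ k) = (multiples (p ^ n) :: 'a set)"
    using coHopfian_multiples_stable[OF G] by blast
  \<comment> \<open>Descent from n, where the socle lies in a divisible group, to 0, where p^0 G is
    G.\<close>
  have "finite ({x. p \<cdot> x = 0} \<inter> multiples (p ^ 0) :: 'a set)"
    by (rule inc_induct[of 0 n]) (use finite_socle_divisible[OF G p n] finite_socle_step[OF G p] in auto)
  moreover have "{x::'a. p \<cdot> x = 0} \<subseteq> {x. p \<cdot> x = 0} \<inter> multiples (p ^ 0)"
    by (auto simp: image_def)
  ultimately show ?thesis by (rule rev_finite_subset)
qed

text \<open>A nonempty fibre of multiplication by p is a coset of the socle, hence finite.\<close>

lemma finite_annihilator_power:
  assumes fin: "finite {x::'a::ab_group_add. p \<cdot> x = 0}"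
  shows "finite {x::'a. p ^ j \<cdot> x = 0}"
proof (induction j)
  case (Suc j)
  have "finite {x::'a. p \<cdot> x = y}" for y
  proof (cases "\<exists>x0. p \<cdot> x0 = y")
    case True
    then obtain x0 where x0: "p \<cdot> x0 = y" by blast
    have "{x. p \<cdot> x = y} \<subseteq> (\<lambda>s. x0 + s) ` {x. p \<cdot> x = 0}"
    proof
      fix x assume "x \<in> {x. p \<cdot> x = y}"
      then show "x \<in> (\<lambda>s. x0 + s) ` {x. p \<cdot> x = 0}"
        using x0 by (intro image_eqI[of _ _ "x - x0"]) (auto simp: Z.scale_right_diff_distrib)
    qed
    then show ?thesis using fin by (meson finite_imageI finite_subset)
  qed auto
  then have "finite (\<Union>y\<in>{x::'a. p ^ j \<cdot> x = 0}. {x. p \<cdot> x = y})" using Suc by blast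
  moreover have "{x::'a. p ^ Suc j \<cdot> x = 0} \<subseteq> (\<Union>y\<in>{x::'a. p ^ j \<cdot> x = 0}. {x. p \<cdot> x = y})"
    by (auto simp: mult.commute)
  ultimately show ?case by (rule rev_finite_subset)
qed simp

section \<open>Primary components\<close>

lemma torsion_iff: "x \<in> torsion_subgroup \<longleftrightarrow> (\<exists>k. k \<noteq> 0 \<and> k \<cdot> x = 0)"
proof
  assume "x \<in> torsion_subgroup"
  then obtain n :: nat where "n > 0" "int n \<cdot> x = 0"
    unfolding torsion_subgroup_def zmult_of_nat by blast
  then show "\<exists>k. k \<noteq> 0 \<and> k \<cdot> x = 0" by (intro exI[of _ "int n"]) simp
next
  assume "\<exists>k. k \<noteq> 0 \<and> k \<cdot> x = 0"
  then obtain k where k: "k \<noteq> 0" "k \<cdot> x = 0" by blast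
  then have "int (nat \<bar>k\<bar>) \<cdot> x = 0" by (simp add: abs_if)
  then show "x \<in> torsion_subgroup"
    unfolding torsion_subgroup_def zmult_of_nat using k(1)
    by (intro CollectI exI[of _ "nat \<bar>k\<bar>"]) simp
qed

lemma subspace_torsion: "Z.subspace (torsion_subgroup :: 'a::ab_group_add set)"
proof (rule subspaceI)
  fix x y :: 'a assume "x \<in> torsion_subgroup" "y \<in> torsion_subgroup"
  then obtain j k where jk: "j \<noteq> 0" "k \<noteq> 0" "j \<cdot> x = 0" "k \<cdot> y = 0" unfolding torsion_iff by blast
  have "(j * k) \<cdot> (x + y) = k \<cdot> j \<cdot> x + j \<cdot> k \<cdot> y"
    by (simp add: zmult_add_right mult.commute)
  then show "x + y \<in> torsion_subgroup"
    unfolding torsion_iff using jk by (intro exI[of _ "j * k"]) (simp del: Z.scale_scale)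
qed (auto simp: torsion_iff intro: exI[of _ 1])

lemma primary_subset_torsion: "prime p \<Longrightarrow> primary p \<subseteq> torsion_subgroup"
  unfolding primary_def by (auto simp: torsion_iff intro!: exI[of _ "p ^ k" for k])

text \<open>The decomposition of T into its p-parts as an induction rule, so that no decomposition
  has to be chosen. If n x = 0 and q is the full power of p in n = q m, Bezout splits x into a part
  killed by m < n and a part killed by q.\<close>

lemma torsion_induct [consumes 1, case_names primary add]:
  assumes "x \<in> torsion_subgroup"
    and primary: "\<And>p y. prime p \<Longrightarrow> y \<in> primary p \<Longrightarrow> P y"
    and add: "\<And>y z. P y \<Longrightarrow> P z \<Longrightarrow> P (y + z)"
  shows "P x"
proof -
  have "P x" if "n > 0" "int n \<cdot> x = 0" for n x
    using that
  proof (induction n arbitrary: x rule: less_induct)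
    case (less n)
    show ?case
    proof (cases "n = 1")
      case True
      \<comment> \<open>Here x = 0, and the prime 2 is an arbitrary choice.\<close>
      then have "x \<in> primary 2" using less by (simp add: primary_def)
      then show ?thesis by (rule primary[rotated]) simp
    next
      case False
      then obtain p where p: "prime p" "p dvd n" using prime_factor_nat by blast
      have "n \<noteq> 0" "\<not> is_unit p" using less p by auto
      then obtain m where m: "n = p ^ multiplicity p n * m" "\<not> p dvd m"
        by (rule multiplicity_decompose')
      let ?q = "p ^ multiplicity p n"
      have mult: "multiplicity p n > 0" using p \<open>n \<noteq> 0\<close> by (simp add: prime_multiplicity_gt_zero_iff)
      then have "?q > 1" using prime_gt_1_nat[OF p(1)] by (rule one_less_power[rotated])
      moreover have "m > 0" using m \<open>n \<noteq> 0\<close> by (metis mult_0_right gr0I)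
      ultimately have mn: "m < n" using m(1) by (metis mult_less_cancel2 mult_1)
      have "coprime ?q m" using p(1) m(2) by (simp add: prime_imp_coprime)
      then have "coprime (int ?q) (int m)" by simp
      then obtain c e where ce: "x = c \<cdot> int ?q \<cdot> x + e \<cdot> int m \<cdot> x" using bezout_zmult by blast
      have n: "int n = int ?q * int m" using m(1) by (metis of_nat_mult)
      have "int m \<cdot> c \<cdot> int ?q \<cdot> x = c \<cdot> int n \<cdot> x" unfolding n by (simp add: ac_simps)
      then have 1: "P (c \<cdot> int ?q \<cdot> x)" using less.IH[OF mn \<open>m > 0\<close>] less.prems(2) by simp
      have "int p ^ multiplicity p n \<cdot> e \<cdot> int m \<cdot> x = e \<cdot> int n \<cdot> x" unfolding n by (simp add: ac_simps)
      then have "int p ^ multiplicity p n \<cdot> e \<cdot> int m \<cdot> x = 0" using less.prems(2) by simp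
      then have "e \<cdot> int m \<cdot> x \<in> primary (int p)" unfolding primary_def by blast
      then have 2: "P (e \<cdot> int m \<cdot> x)" using p(1) by (intro primary) auto
      show ?thesis using add[OF 1 2] ce by simp
    qed
  qed
  then show ?thesis using assms(1) unfolding torsion_subgroup_def zmult_of_nat by blast
qed

lemma primary_Int:
  assumes "prime p" "prime q" "p \<noteq> q" "x \<in> primary p" "x \<in> primary q"
  shows "x = 0"
proof -
  obtain j k where jk: "p ^ j \<cdot> x = 0" "q ^ k \<cdot> x = 0" using assms(4,5) unfolding primary_def by blast
  have "coprime (p ^ j) (q ^ k)" using assms(1-3) by (simp add: primes_coprime)
  then obtain c e where "x = c \<cdot> p ^ j \<cdot> x + e \<cdot> q ^ k \<cdot> x" using bezout_zmult by blast
  then show ?thesis unfolding jk by simp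
qed

lemma endo_on_primary:
  assumes f: "endo_on S f" and S: "Z.subspace S" "primary p \<subseteq> S"
  shows "endo_on (primary p) f"
  unfolding endo_on_def
proof (intro conjI)
  show "f ` primary p \<subseteq> primary p"
  proof
    fix y assume "y \<in> f ` primary p"
    then obtain x where x: "x \<in> primary p" "y = f x" by blast
    then obtain k where "p ^ k \<cdot> x = 0" unfolding primary_def by blast
    then have "p ^ k \<cdot> f x = 0"
      using endo_on_zmult[OF f S(1), of x "p ^ k"] endo_on_zero[OF f S(1)] x S(2) by auto
    then show "y \<in> primary p" unfolding x(2) primary_def by blast
  qed
  show "\<forall>x\<in>primary p. \<forall>y\<in>primary p. f (x + y) = f x + f y"
    using f S(2) unfolding endo_on_def by blast
qed

lemma endo_image_subspace:
  assumes f: "endo_on S f" and S: "Z.subspace S" and D: "Z.subspace D" "D \<subseteq> S"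
  shows "Z.subspace (f ` D)"
proof (rule subspaceI)
  show "0 \<in> f ` D" using endo_on_zero[OF f S] Z.subspace_0[OF D(1)] by (metis imageI)
  show "x + y \<in> f ` D" if xy: "x \<in> f ` D" "y \<in> f ` D" for x y
  proof -
    obtain a b where ab: "a \<in> D" "b \<in> D" "x = f a" "y = f b" using xy by blast
    then have "f (a + b) = x + y" using f D(2) unfolding endo_on_def by blast
    then show ?thesis using Z.subspace_add[OF D(1) ab(1,2)] by (metis imageI)
  qed
  show "- x \<in> f ` D" if x: "x \<in> f ` D" for x
  proof -
    obtain a where a: "a \<in> D" "x = f a" using x by blast
    then have "f (- a) = - x" using endo_on_minus[OF f S] D(2) by blast
    then show ?thesis using Z.subspace_neg[OF D(1) a(1)] by (metis imageI)
  qed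
qed

text \<open>The divisible part D of T_p splits off G by a projection \<open>\<pi>\<close> extending
  the identity of D. The complement of all of T_p is then cut out of the kernel of
  \<open>\<pi>\<close>.\<close>

lemma primary_projection:
  assumes G: "strongly_coHopfian (UNIV :: 'a::ab_group_add set)" and p: "prime p"
  obtains e where "endo e" "range e \<subseteq> (primary p :: 'a set)" "\<And>x. x \<in> primary p \<Longrightarrow> e x = x"
proof -
  obtain n where n: "\<And>k. n \<le> k \<Longrightarrow> multiples (p ^ k) = (multiples (p ^ n) :: 'a set)"
    using coHopfian_multiples_stable[OF G] by blast
  define D where "D = (primary p \<inter> multiples (p ^ n) :: 'a set)"
  have D: "Z.subspace D" "divisible D"
    unfolding D_def by (rule divisible_primary_multiples[OF p n]; assumption)+
  define R0 where "R0 = {(d, d) | d. d \<in> D}"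
  have "Z.subspace R0"
    unfolding R0_def using Z.subspace_0[OF D(1)] Z.subspace_add[OF D(1)] Z.subspace_neg[OF D(1)]
    by (intro subspaceI) (auto simp: zero_prod_def)
  moreover have "y = 0" if "(0, y) \<in> R0" for y using that unfolding R0_def by auto
  moreover have "snd ` R0 \<subseteq> D" unfolding R0_def by auto
  ultimately obtain \<pi> where \<pi>: "endo \<pi>" "range \<pi> \<subseteq> D" "\<And>x y. (x, y) \<in> R0 \<Longrightarrow> \<pi> x = y"
    using extend_into_divisible[OF D] by (smt (verit))
  have \<pi>D: "\<pi> d = d" if "d \<in> D" for d using \<pi>(3)[of d d] that unfolding R0_def by blast
  have \<pi>in: "\<pi> x \<in> D" for x using \<pi>(2) by blast
  \<comment> \<open>The complement of T_p. An element of both lies in T_p and in p^n G, hence in D,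
    and it is killed by \<open>\<pi>\<close>, hence 0.\<close>
  define Q where "Q = zmult (p ^ n) ` {b. \<pi> b = 0}"
  have Qker: "\<pi> q = 0" if "q \<in> Q" for q using that endo_zmult[OF \<pi>(1)] unfolding Q_def by auto
  have sQ: "Z.subspace Q"
    unfolding Q_def
  proof (rule endo_image_subspace[OF _ Z.subspace_UNIV])
    show "Z.subspace {b. \<pi> b = 0}"
      using endo_zero[OF \<pi>(1)] endo_add[OF \<pi>(1)] endo_minus[OF \<pi>(1)] by (intro subspaceI) auto
  qed (auto intro: endoI zmult_add_right)
  define R where "R = {(t + q, t) | t q. t \<in> primary p \<and> q \<in> Q}"
  have "Z.subspace R"
  proof (rule subspaceI)
    have "(0 + 0, 0) \<in> R" unfolding R_def using Z.subspace_0[OF sQ] Z.subspace_0[OF subspace_primary] by blast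
    then show "0 \<in> R" by (simp add: zero_prod_def)
  next
    fix u v assume "u \<in> R" "v \<in> R"
    then obtain t q t' q' where *: "u = (t + q, t)" "v = (t' + q', t')" "t \<in> primary p" "q \<in> Q"
      "t' \<in> primary p" "q' \<in> Q" unfolding R_def by blast
    then have "u + v = ((t + t') + (q + q'), t + t')" by (simp add: algebra_simps)
    then show "u + v \<in> R" unfolding R_def
      using Z.subspace_add[OF sQ *(4,6)] Z.subspace_add[OF subspace_primary *(3,5)] by blast
  next
    fix u assume "u \<in> R"
    then obtain t q where *: "u = (t + q, t)" "t \<in> primary p" "q \<in> Q" unfolding R_def by blast
    then have "- u = (- t + - q, - t)" by (simp add: algebra_simps)
    then show "- u \<in> R" unfolding R_def
      using Z.subspace_neg[OF sQ *(3)] Z.subspace_neg[OF subspace_primary *(2)] by blast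
  qed
  moreover have "y = 0" if y: "(0, y) \<in> R" for y
  proof -
    obtain q where *: "y \<in> primary p" "q \<in> Q" "y + q = 0" using y unfolding R_def by auto
    have yq: "q = - y" using *(3) by (metis eq_neg_iff_add_eq_0 add.commute)
    then have "q \<in> D" using *(1,2) Z.subspace_neg[OF subspace_primary *(1)] unfolding D_def Q_def by auto
    then have "q = 0" using \<pi>D Qker[OF *(2)] by simp
    then show ?thesis using yq by simp
  qed
  moreover have "\<exists>t. (x, t) \<in> R" for x
  proof -
    define b where "b = x - \<pi> x"
    have b: "\<pi> b = 0" unfolding b_def endo_diff[OF \<pi>(1)] using \<pi>D[OF \<pi>in[of x]] by simp
    have "p ^ n \<cdot> b \<in> multiples (p ^ (n + n))" using n[of "n + n"] by simp
    then obtain y where y: "p ^ n \<cdot> b = p ^ (n + n) \<cdot> y" by blast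
    define c where "c = y - \<pi> y"
    have c: "\<pi> c = 0" unfolding c_def endo_diff[OF \<pi>(1)] using \<pi>D[OF \<pi>in[of y]] by simp
    have "p ^ (n + n) \<cdot> c = p ^ (n + n) \<cdot> y - \<pi> (p ^ (n + n) \<cdot> y)"
      unfolding c_def endo_zmult[OF \<pi>(1)] by (simp add: Z.scale_right_diff_distrib)
    also have "\<dots> = p ^ n \<cdot> b" unfolding y[symmetric] endo_zmult[OF \<pi>(1)] b by simp
    finally have pc: "p ^ (n + n) \<cdot> c = p ^ n \<cdot> b" .
    \<comment> \<open>The T_p-component of x: p^n t = p^n (\<open>\<pi> x\<close>) lies in T_p, and
      therefore so does t.\<close>
    define t where "t = x - p ^ n \<cdot> c"
    have "p ^ n \<cdot> t = p ^ n \<cdot> x - p ^ (n + n) \<cdot> c"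
      unfolding t_def by (simp add: Z.scale_right_diff_distrib power_add)
    also have "\<dots> = p ^ n \<cdot> \<pi> x" unfolding pc b_def by (simp add: Z.scale_right_diff_distrib)
    finally have "p ^ n \<cdot> t \<in> primary p"
      using \<pi>in[of x] Z.subspace_scale[OF subspace_primary, of "\<pi> x"] unfolding D_def by simp
    then have "t \<in> primary p" by (simp only: primary_zmult_cancel)
    moreover have "p ^ n \<cdot> c \<in> Q" unfolding Q_def using c by blast
    moreover have "x = t + p ^ n \<cdot> c" unfolding t_def by simp
    ultimately show ?thesis unfolding R_def by blast
  qed
  ultimately obtain e where e: "endo e" "\<And>x y. (x, y) \<in> R \<longleftrightarrow> y = e x"
    using total_relation_endo by (smt (verit))
  have "e x \<in> primary p" for x using e(2)[of x "e x"] unfolding R_def by auto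
  moreover have "e x = x" if x: "x \<in> primary p" for x
  proof -
    have "(x + 0, x) \<in> R" unfolding R_def using x Z.subspace_0[OF sQ] by blast
    then show ?thesis using e(2)[of x x] by simp
  qed
  ultimately show thesis using that[OF e(1)] by blast
qed

section \<open>Stationary indices in extensions and in primary components\<close>

lemma decreasing_chain_stationary:
  fixes X :: "nat \<Rightarrow> 'b set"
  assumes fin: "finite (X 0)" and dec: "\<And>k. X (Suc k) \<subseteq> X k"
  shows "\<exists>k\<le>card (X 0). X (Suc k) = X k"
proof (rule ccontr)
  assume c: "\<not> (\<exists>k\<le>card (X 0). X (Suc k) = X k)"
  have f: "finite (X k)" for k by (induction k) (use fin finite_subset[OF dec] in auto)
  have "card (X k) + k \<le> card (X 0)" if "k \<le> Suc (card (X 0))" for k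
    using that
  proof (induction k)
    case (Suc k)
    then have "X (Suc k) \<subset> X k" using c dec[of k] by auto
    then have "card (X (Suc k)) < card (X k)" using f psubset_card_mono by blast
    then show ?case using Suc by simp
  qed simp
  from this[of "Suc (card (X 0))"] show False by simp
qed

lemma funpow_image_const:
  fixes f :: "'b \<Rightarrow> 'b"
  assumes "(f ^^ n) ` S = (f ^^ Suc n) ` S" "n \<le> k"
  shows "(f ^^ k) ` S = (f ^^ n) ` S"
  using assms(2)
proof (induction k rule: dec_induct)
  case (step k)
  then show ?case using funpow_image_eq_mono[OF assms(1), of k] by simp
qed simp

text \<open>Indices add along an extension of D by A/D. Write f^k a = f^(k+1) a' + d with d in D;
  applying f^s moves d into f^s D, which equals f^(s+k+1) D. The assumption \<open>quot\<close> is
  stationarity in A/D, stated on elements so that no quotient group is formed.\<close>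

lemma extension_stable:
  assumes f: "endo_on A f" and A: "Z.subspace A" and D: "D \<subseteq> A"
    and quot: "\<And>a. a \<in> A \<Longrightarrow> \<exists>a'\<in>A. (f ^^ k) a - (f ^^ Suc k) a' \<in> D"
    and sub: "(f ^^ s) ` D = (f ^^ Suc s) ` D"
  shows "(f ^^ (s + k)) ` A = (f ^^ Suc (s + k)) ` A"
proof (rule funpow_image_eqI)
  show "f ` A \<subseteq> A" using f unfolding endo_on_def by blast
  show "(f ^^ (s + k)) ` A \<subseteq> (f ^^ Suc (s + k)) ` A"
  proof
    fix y assume "y \<in> (f ^^ (s + k)) ` A"
    then obtain a where a: "a \<in> A" "y = (f ^^ (s + k)) a" by blast
    obtain a' where a': "a' \<in> A" "(f ^^ k) a - (f ^^ Suc k) a' \<in> D" using quot[OF a(1)] by blast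
    define d where "d = (f ^^ k) a - (f ^^ Suc k) a'"
    have "(f ^^ s) d \<in> (f ^^ s) ` D" using a' unfolding d_def by blast
    also have "\<dots> = (f ^^ Suc (s + k)) ` D" using funpow_image_const[OF sub, of "Suc (s + k)"] by simp
    finally obtain d' where d': "d' \<in> D" "(f ^^ s) d = (f ^^ Suc (s + k)) d'" by blast
    have e: "endo_on A (f ^^ j)" for j by (rule endo_on_funpow[OF f])
    have mem: "(f ^^ j) b \<in> A" if "b \<in> A" for j b using e[of j] that unfolding endo_on_def by blast
    have "(f ^^ k) a = (f ^^ Suc k) a' + d" unfolding d_def by simp
    then have "y = (f ^^ s) ((f ^^ Suc k) a' + d)" unfolding a(2) by (simp add: funpow_add)
    also have "\<dots> = (f ^^ s) ((f ^^ Suc k) a') + (f ^^ s) d"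
      using e[of s] mem[OF a'(1), of "Suc k"] D a' unfolding endo_on_def d_def by blast
    also have "(f ^^ s) ((f ^^ Suc k) a') = (f ^^ Suc (s + k)) a'"
      using funpow_add[of s "Suc k" f] by simp
    also have "(f ^^ Suc (s + k)) a' + (f ^^ s) d = (f ^^ Suc (s + k)) (a' + d')"
      unfolding d'(2) using e[of "Suc (s + k)"] a'(1) d'(1) D unfolding endo_on_def by (metis subsetD)
    finally show "y \<in> (f ^^ Suc (s + k)) ` A"
      using Z.subspace_add[OF A a'(1)] d'(1) D by blast
  qed
qed

text \<open>If p x lies in the p-divisible E, then x differs from an element of E by an element of
  the socle; induct on the exponent of x. Thus p-divisible p-primary groups, one inside the other,
  are equal once their socles are.\<close>

lemma primary_subset_of_socle_subset:
  assumes E: "Z.subspace E" "E \<subseteq> E'" "\<And>u. u \<in> E \<Longrightarrow> \<exists>v\<in>E. p \<cdot> v = u"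
    and E': "Z.subspace E'" "E' \<subseteq> primary p"
    and soc: "E' \<inter> {x. p \<cdot> x = 0} \<subseteq> E"
  shows "E' \<subseteq> E"
proof -
  have "x \<in> E" if "x \<in> E'" "p ^ j \<cdot> x = 0" for x j
    using that
  proof (induction j arbitrary: x)
    case 0 then show ?case using Z.subspace_0[OF E(1)] by simp
  next
    case (Suc j)
    have "p ^ j \<cdot> p \<cdot> x = 0" using Suc.prems(2) by (simp add: mult.commute)
    then have "p \<cdot> x \<in> E" using Suc.IH Z.subspace_scale[OF E'(1) Suc.prems(1)] by blast
    then obtain v where v: "v \<in> E" "p \<cdot> v = p \<cdot> x" using E(3) by blast
    have "x - v \<in> E'" using Z.subspace_diff[OF E'(1) Suc.prems(1)] v(1) E(2) by blast
    then have "x - v \<in> E" using soc v(2) by (auto simp: Z.scale_right_diff_distrib)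
    from Z.subspace_add[OF E(1) this v(1)] show ?case by simp
  qed
  then show ?thesis using E'(2) unfolding primary_def by blast
qed

text \<open>Since p^n x = p^(2n) y for some y, the difference x - p^n y is killed by p^n. With a
  finite socle this makes G/p^n G finite, with representatives in T_p.\<close>

lemma annihilator_plus_multiples:
  assumes n: "\<And>k. n \<le> k \<Longrightarrow> multiples (p ^ k) = (multiples (p ^ n) :: 'a::ab_group_add set)"
  obtains t d where "(x::'a) = t + d" "p ^ n \<cdot> t = 0" "d \<in> multiples (p ^ n)"
proof -
  have "p ^ n \<cdot> x \<in> multiples (p ^ (n + n))" using n[of "n + n"] by simp
  then obtain y where "p ^ n \<cdot> x = p ^ (n + n) \<cdot> y" by blast
  then have "p ^ n \<cdot> (x - p ^ n \<cdot> y) = 0" by (simp add: Z.scale_right_diff_distrib power_add)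
  then show thesis by (intro that[of "x - p ^ n \<cdot> y" "p ^ n \<cdot> y"]) auto
qed

text \<open>T_p is an extension of the divisible D by a finite group. The images of D form a chain
  controlled by their socles, of at most \<open>card ?S\<close> steps; in T_p/D the set
  \<open>?F\<close> contains representatives of all classes, which allows at most
  \<open>card ?F\<close> steps. Neither number depends on f.\<close>

lemma primary_uniformly_coHopfian:
  assumes G: "strongly_coHopfian (UNIV :: 'a::ab_group_add set)" and p: "prime p"
  shows "uniformly_strongly_coHopfian (primary p :: 'a set)"
proof -
  obtain n where n: "\<And>k. n \<le> k \<Longrightarrow> multiples (p ^ k) = (multiples (p ^ n) :: 'a set)"
    using coHopfian_multiples_stable[OF G] by blast
  let ?A = "primary p :: 'a set" and ?S = "{x::'a. p \<cdot> x = 0}" and ?F = "{x::'a. p ^ n \<cdot> x = 0}"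
  define D where "D = ?A \<inter> multiples (p ^ n)"
  have D: "Z.subspace D" "divisible D"
    unfolding D_def by (rule divisible_primary_multiples[OF p n]; assumption)+
  have fin: "finite ?S" "finite ?F"
    using finite_socle[OF G p] finite_annihilator_power by blast+
  note sA = subspace_primary[of p, where 'a = 'a]
  have "(f ^^ (card ?S + card ?F)) ` ?A = (f ^^ Suc (card ?S + card ?F)) ` ?A" if f: "endo_on ?A f" for f
  proof -
    have e: "endo_on ?A (f ^^ j)" for j by (rule endo_on_funpow[OF f])
    have fA: "f a \<in> ?A" if "a \<in> ?A" for a using f that unfolding endo_on_def by blast
    have fD: "f ` D \<subseteq> D"
    proof
      fix y assume "y \<in> f ` D"
      then obtain x where x: "p ^ n \<cdot> x \<in> ?A" "y = f (p ^ n \<cdot> x)" unfolding D_def by blast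
      then have xA: "x \<in> ?A" by (simp only: primary_zmult_cancel)
      then have "y = p ^ n \<cdot> f x" using endo_on_zmult[OF f sA] x by blast
      moreover have "p ^ n \<cdot> f x \<in> ?A" using Z.subspace_scale[OF sA fA[OF xA]] .
      ultimately show "y \<in> D" unfolding D_def by simp
    qed
    have sub: "(f ^^ card ?S) ` D = (f ^^ Suc (card ?S)) ` D"
    proof -
      \<comment> \<open>Each image of D is p-divisible, so two successive images agree as soon as
        their socles do.\<close>
      define X where "X k = (f ^^ k) ` D \<inter> ?S" for k
      have "X (Suc k) \<subseteq> X k" for k
        unfolding X_def using funpow_image_antimono[OF fD, of k "Suc k"] by auto
      moreover have "finite (X 0)" using fin unfolding X_def by auto
      ultimately obtain k where k: "k \<le> card (X 0)" "X (Suc k) = X k"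
        using decreasing_chain_stationary[of X] by blast
      have "card (X 0) \<le> card ?S" using fin unfolding X_def by (intro card_mono) auto
      then have kS: "k \<le> card ?S" using k(1) by simp
      have sD: "Z.subspace ((f ^^ j) ` D)" for j
        by (rule endo_image_subspace[OF e sA D(1)]) (simp add: D_def)
      have "(f ^^ k) ` D \<subseteq> (f ^^ Suc k) ` D"
      proof (rule primary_subset_of_socle_subset[OF sD _ _ sD])
        show "(f ^^ Suc k) ` D \<subseteq> (f ^^ k) ` D" by (rule funpow_image_antimono[OF fD]) simp
        show "(f ^^ k) ` D \<subseteq> primary p" using e[of k] unfolding endo_on_def D_def by blast
        show "(f ^^ k) ` D \<inter> ?S \<subseteq> (f ^^ Suc k) ` D" using k(2) unfolding X_def by blast
        fix u assume "u \<in> (f ^^ Suc k) ` D"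
        then obtain d where d: "d \<in> D" "u = (f ^^ Suc k) d" by blast
        obtain v where v: "v \<in> D" "p \<cdot> v = d" using D(2) d(1) p unfolding divisible_def by (metis not_prime_0)
        have "u = p \<cdot> (f ^^ Suc k) v"
          using endo_on_zmult[OF e[of "Suc k"] sA, of v p] v d(2) unfolding D_def by auto
        then show "\<exists>v\<in>(f ^^ Suc k) ` D. p \<cdot> v = u" using v(1) by blast
      qed
      then have "(f ^^ k) ` D = (f ^^ Suc k) ` D" by (rule funpow_image_eqI[OF fD])
      then show ?thesis using kS by (rule funpow_image_eq_mono)
    qed
    \<comment> \<open>The representatives in \<open>?F\<close> whose class modulo D lies in the k-th
      image of T_p.\<close>
    define Y where "Y k = {t \<in> ?F. \<exists>a\<in>?A. t - (f ^^ k) a \<in> D}" for k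
    have "Y (Suc k) \<subseteq> Y k" for k
    proof
      fix t assume "t \<in> Y (Suc k)"
      then obtain a where "t \<in> ?F" "a \<in> ?A" "t - (f ^^ Suc k) a \<in> D" unfolding Y_def by blast
      then have "t \<in> ?F" "f a \<in> ?A" "t - (f ^^ k) (f a) \<in> D" using fA by (auto simp: funpow_swap1)
      then show "t \<in> Y k" unfolding Y_def by blast
    qed
    moreover have "finite (Y 0)" using fin unfolding Y_def by auto
    ultimately obtain k where k: "k \<le> card (Y 0)" "Y (Suc k) = Y k"
      using decreasing_chain_stationary[of Y] by blast
    have "card (Y 0) \<le> card ?F" using fin unfolding Y_def by (intro card_mono) auto
    then have kF: "k \<le> card ?F" using k(1) by simp
    have "\<exists>a'\<in>?A. (f ^^ k) a - (f ^^ Suc k) a' \<in> D" if a: "a \<in> ?A" for a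
    proof -
      obtain t d where td: "(f ^^ k) a = t + d" "p ^ n \<cdot> t = 0" "d \<in> multiples (p ^ n)"
        using annihilator_plus_multiples[OF n] by metis
      have "(f ^^ k) a \<in> ?A" using e[of k] a unfolding endo_on_def by blast
      moreover have "t \<in> ?A" using td(2) unfolding primary_def by blast
      moreover have "d = (f ^^ k) a - t" using td(1) by simp
      ultimately have d: "d \<in> D" using td(3) Z.subspace_diff[OF sA] unfolding D_def by blast
      have "t - (f ^^ k) a \<in> D" using Z.subspace_neg[OF D(1) d] unfolding td(1) by simp
      then have "t \<in> Y k" using td(2) a unfolding Y_def by blast
      then obtain a' where a': "a' \<in> ?A" "t - (f ^^ Suc k) a' \<in> D" using k(2) unfolding Y_def by blast
      have "(f ^^ k) a - (f ^^ Suc k) a' = (t - (f ^^ Suc k) a') + d" unfolding td(1) by simp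
      then show ?thesis using Z.subspace_add[OF D(1) a'(2) d] a'(1) by metis
    qed
    then have "(f ^^ (card ?S + k)) ` ?A = (f ^^ Suc (card ?S + k)) ` ?A"
      by (intro extension_stable[OF f sA _ _ sub]) (auto simp: D_def)
    then show ?thesis by (rule funpow_image_eq_mono) (use kF in simp)
  qed
  then show ?thesis unfolding uniformly_strongly_coHopfian_def by blast
qed

section \<open>Passing between the torsion subgroup and its primary components\<close>

lemma endo_on_torsion:
  assumes f: "endo f" shows "endo_on torsion_subgroup f"
  unfolding endo_on_def
proof (intro conjI ballI subsetI)
  fix y assume "y \<in> f ` torsion_subgroup"
  then obtain x k where "y = f x" "k \<noteq> 0" "k \<cdot> x = 0" by (auto simp: torsion_iff)
  then have "k \<cdot> y = 0" using endo_zmult[OF f, of k x] endo_zero[OF f] by simp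
  then show "y \<in> torsion_subgroup" using \<open>k \<noteq> 0\<close> unfolding torsion_iff by blast
qed (rule endo_add[OF f])

lemma torsion_stable_of_primary:
  assumes f: "endo_on (torsion_subgroup :: 'a::ab_group_add set) f"
    and st: "\<And>p. prime p \<Longrightarrow> (f ^^ m) ` primary p = (f ^^ Suc m) ` (primary p :: 'a set)"
  shows "(f ^^ m) ` torsion_subgroup = (f ^^ Suc m) ` (torsion_subgroup :: 'a set)"
proof (rule funpow_image_eqI)
  show "f ` torsion_subgroup \<subseteq> torsion_subgroup" using f unfolding endo_on_def by blast
  have e: "endo_on (torsion_subgroup :: 'a set) (f ^^ j)" for j by (rule endo_on_funpow[OF f])
  \<comment> \<open>Membership is carried through the induction because f is additive only on
    T.\<close>
  have "x \<in> torsion_subgroup \<and> (\<exists>y\<in>torsion_subgroup. (f ^^ m) x = (f ^^ Suc m) y)"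
    if "x \<in> torsion_subgroup" for x
    using that
  proof (induction rule: torsion_induct)
    case (primary p y)
    then have "(f ^^ m) y \<in> (f ^^ Suc m) ` primary p" using st[OF primary(1)] by blast
    then show ?case using primary primary_subset_torsion[OF primary(1)] by blast
  next
    case (add y z)
    then obtain y' z' where yz: "y' \<in> torsion_subgroup" "(f ^^ m) y = (f ^^ Suc m) y'"
      "z' \<in> torsion_subgroup" "(f ^^ m) z = (f ^^ Suc m) z'" by blast
    have "(f ^^ m) (y + z) = (f ^^ m) y + (f ^^ m) z" using e[of m] add unfolding endo_on_def by blast
    also have "\<dots> = (f ^^ Suc m) (y' + z')" using e[of "Suc m"] yz unfolding endo_on_def by metis
    finally show ?case using Z.subspace_add[OF subspace_torsion] add yz by blast
  qed
  then show "(f ^^ m) ` torsion_subgroup \<subseteq> (f ^^ Suc m) ` (torsion_subgroup :: 'a set)" by blast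
qed

text \<open>For each prime, f composed with the projection e onto T_p is an endomorphism of G that
  agrees with f on T_p, so the bound for G applies to it; as that bound ignores p, the components
  can be reassembled.\<close>

lemma torsion_coHopfian_if_uniform:
  assumes G: "strongly_coHopfian (UNIV :: 'a::ab_group_add set)"
    and uni: "uniformly_strongly_coHopfian (UNIV :: 'a set)"
  shows "strongly_coHopfian (torsion_subgroup :: 'a set)"
  unfolding strongly_coHopfian_def
proof (intro allI impI)
  fix f :: "'a \<Rightarrow> 'a" assume f: "endo_on torsion_subgroup f"
  obtain m where m: "\<And>h :: 'a \<Rightarrow> 'a. endo h \<Longrightarrow> (h ^^ m) ` UNIV = (h ^^ Suc m) ` UNIV"
    using uni unfolding uniformly_strongly_coHopfian_def by blast
  have "(f ^^ Suc m) ` primary p = (f ^^ Suc (Suc m)) ` primary p" if p: "prime p" for p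
  proof -
    obtain e where e: "endo e" "range e \<subseteq> (primary p :: 'a set)" "\<And>x. x \<in> primary p \<Longrightarrow> e x = x"
      using primary_projection[OF G p] by blast
    note fp = endo_on_primary[OF f subspace_torsion primary_subset_torsion[OF p]]
    have fpA: "f x \<in> primary p" if "x \<in> primary p" for x using fp that unfolding endo_on_def by blast
    define h where "h = f \<circ> e"
    have h: "endo h"
    proof (rule endoI)
      fix x y
      have "e x \<in> primary p" "e y \<in> primary p" using e(2) by auto
      then show "h (x + y) = h x + h y" using fp endo_add[OF e(1)] unfolding h_def endo_on_def by auto
    qed
    \<comment> \<open>At exponent 0 the formula would fail, since h^0 is the identity and not e;
      this is why the index becomes \<open>Suc m\<close>.\<close>
    have hj: "(h ^^ Suc j) x = (f ^^ Suc j) (e x) \<and> (f ^^ Suc j) (e x) \<in> primary p" for j x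
    proof (induction j)
      case 0 then show ?case using fpA e(2) unfolding h_def by auto
    next
      case (Suc j)
      then show ?case using fpA e(3) unfolding h_def by simp
    qed
    have st: "(h ^^ Suc m) ` UNIV = (h ^^ Suc (Suc m)) ` UNIV"
      using m[OF h] by (rule funpow_image_eq_mono) simp
    have "(f ^^ Suc m) ` primary p \<subseteq> (f ^^ Suc (Suc m)) ` primary p"
    proof
      fix y assume "y \<in> (f ^^ Suc m) ` primary p"
      then obtain x where x: "x \<in> primary p" "y = (f ^^ Suc m) x" by blast
      then have "y = (h ^^ Suc m) x" using hj[of m x] e(3) by simp
      then have "y \<in> (h ^^ Suc (Suc m)) ` UNIV" using st by blast
      then obtain z where "y = (h ^^ Suc (Suc m)) z" by blast
      then have "y = (f ^^ Suc (Suc m)) (e z)" using hj[of "Suc m" z] by simp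
      then show "y \<in> (f ^^ Suc (Suc m)) ` primary p" using e(2) by blast
    qed
    moreover have "f ` primary p \<subseteq> primary p" using fp unfolding endo_on_def by blast
    ultimately show ?thesis by (intro funpow_image_eqI)
  qed
  then have "(f ^^ Suc m) ` torsion_subgroup = (f ^^ Suc (Suc m)) ` torsion_subgroup"
    by (rule torsion_stable_of_primary[OF f])
  then show "\<exists>n. (f ^^ n) ` torsion_subgroup = (f ^^ Suc n) ` torsion_subgroup" by blast
qed

text \<open>The least uniform bound M is attained: as M - 1 is no bound, some F violates it. An
  index that suits F therefore suits every endomorphism, and one F per prime is enough for the
  gluing.\<close>

lemma slowest_endo:
  assumes "uniformly_strongly_coHopfian (A :: 'a::ab_group_add set)"
  shows "\<exists>F. endo_on A F \<and> (\<forall>n. (F ^^ n) ` A = (F ^^ Suc n) ` A \<longrightarrow>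
           (\<forall>f. endo_on A f \<longrightarrow> (f ^^ n) ` A = (f ^^ Suc n) ` A))"
proof -
  define Q where "Q n \<longleftrightarrow> (\<forall>f. endo_on A f \<longrightarrow> (f ^^ n) ` A = (f ^^ Suc n) ` A)" for n
  define M where "M = (LEAST n. Q n)"
  have "\<exists>n. Q n" using assms unfolding Q_def uniformly_strongly_coHopfian_def .
  then have QM: "Q M" unfolding M_def by (rule LeastI_ex)
  have mono: "Q n" if "M \<le> n" for n
    unfolding Q_def
  proof (intro allI impI)
    fix f assume "endo_on A f"
    then have "(f ^^ M) ` A = (f ^^ Suc M) ` A" using QM unfolding Q_def by blast
    then show "(f ^^ n) ` A = (f ^^ Suc n) ` A" using that by (rule funpow_image_eq_mono)
  qed
  show ?thesis
    unfolding Q_def[symmetric]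
  proof (cases M)
    case 0
    have "endo_on A id" by (simp add: endo_on_def)
    moreover have "Q n" for n using mono 0 by simp
    ultimately show "\<exists>F. endo_on A F \<and> (\<forall>n. (F ^^ n) ` A = (F ^^ Suc n) ` A \<longrightarrow> Q n)" by blast
  next
    case (Suc j)
    then have "\<not> Q j" using not_less_Least[of j Q] unfolding M_def by simp
    then obtain F where F: "endo_on A F" "(F ^^ j) ` A \<noteq> (F ^^ Suc j) ` A" unfolding Q_def by blast
    have "Q n" if n: "(F ^^ n) ` A = (F ^^ Suc n) ` A" for n
    proof (rule mono, rule ccontr)
      assume "\<not> M \<le> n"
      then have "n \<le> j" using Suc by simp
      then show False using funpow_image_eq_mono[OF n] F(2) by blast
    qed
    then show "\<exists>F. endo_on A F \<and> (\<forall>n. (F ^^ n) ` A = (F ^^ Suc n) ` A \<longrightarrow> Q n)" using F(1) by blast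
  qed
qed

text \<open>The elements \<open>e p x\<close> are the coordinates of x in the direct sum of the T_p.
  On T only finitely many are nonzero, so acting by F p on each coordinate is a finite sum.\<close>

lemma glue_primary_endos:
  fixes F e :: "int \<Rightarrow> 'a::ab_group_add \<Rightarrow> 'a"
  assumes e: "\<And>p. prime p \<Longrightarrow> endo (e p)" "\<And>p x. prime p \<Longrightarrow> e p x \<in> primary p"
      "\<And>p x. prime p \<Longrightarrow> x \<in> primary p \<Longrightarrow> e p x = x"
    and F: "\<And>p. prime p \<Longrightarrow> endo_on (primary p) (F p)"
  shows "\<exists>g. endo_on (torsion_subgroup :: 'a set) g \<and>
    (\<forall>p x. prime p \<longrightarrow> x \<in> torsion_subgroup \<longrightarrow> e p (g x) = F p (e p x))"
proof -
  define supp where "supp x = {p. prime p \<and> e p x \<noteq> 0}" for x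
  have F0: "F p 0 = 0" if "prime p" for p using endo_on_zero[OF F[OF that] subspace_primary] .
  have Fin: "F p x \<in> primary p" if "prime p" "x \<in> primary p" for p x
    using F[OF that(1)] that(2) unfolding endo_on_def by blast
  have ortho: "e p x = 0" if "prime p" "prime q" "p \<noteq> q" "x \<in> primary q" for p q x
  proof -
    have "endo_on (primary q) (e p)" by (rule endo_on_primary[OF e(1)[OF that(1)] Z.subspace_UNIV]) simp
    then have "e p x \<in> primary q" using that(4) unfolding endo_on_def by blast
    then show ?thesis using primary_Int[OF that(1,2,3) e(2)[OF that(1)]] by blast
  qed
  have fin: "finite (supp x)" if "x \<in> torsion_subgroup" for x
    using that
  proof (induction rule: torsion_induct)
    case (primary p y)
    then have "supp y \<subseteq> {p}" using ortho unfolding supp_def by blast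
    then show ?case by (rule finite_subset) simp
  next
    case (add y z)
    have "supp (y + z) \<subseteq> supp y \<union> supp z" using endo_add[OF e(1)] unfolding supp_def by auto
    then show ?case using add finite_subset by blast
  qed
  define g where "g x = (\<Sum>p\<in>supp x. F p (e p x))" for x
  \<comment> \<open>Since F p 0 = 0, the index set may be enlarged; additivity can then be checked
    over the union of two supports.\<close>
  have g_eq: "g x = (\<Sum>p\<in>A. F p (e p x))" if "finite A" "supp x \<subseteq> A" "A \<subseteq> Collect prime" for x A
    unfolding g_def using that F0 by (intro sum.mono_neutral_left) (auto simp: supp_def)
  have "endo_on torsion_subgroup g"
    unfolding endo_on_def
  proof (intro conjI ballI subsetI)
    fix y assume "y \<in> g ` torsion_subgroup"
    then obtain x where "y = g x" by blast
    moreover have "F p (e p x) \<in> torsion_subgroup" if "p \<in> supp x" for p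
      using that Fin e(2) primary_subset_torsion unfolding supp_def by blast
    ultimately show "y \<in> torsion_subgroup"
      unfolding g_def by (simp add: Z.subspace_sum[OF subspace_torsion])
  next
    fix x y :: 'a assume xy: "x \<in> torsion_subgroup" "y \<in> torsion_subgroup"
    let ?A = "supp x \<union> supp y"
    have A: "finite ?A" "?A \<subseteq> Collect prime" "supp (x + y) \<subseteq> ?A"
      using fin xy endo_add[OF e(1)] unfolding supp_def by auto
    have "F p (e p (x + y)) = F p (e p x) + F p (e p y)" if "p \<in> ?A" for p
    proof -
      have p: "prime p" using that A by blast
      then show ?thesis using F[OF p] e(2)[OF p] endo_add[OF e(1)[OF p]] unfolding endo_on_def by metis
    qed
    then show "g (x + y) = g x + g y"
      using g_eq[OF A(1,3,2)] g_eq[OF A(1) _ A(2), of x] g_eq[OF A(1) _ A(2), of y]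
      by (simp add: sum.distrib)
  qed
  moreover have "e q (g x) = F q (e q x)" if q: "prime q" "x \<in> torsion_subgroup" for q x
  proof -
    have A: "finite (insert q (supp x))" "insert q (supp x) \<subseteq> Collect prime"
      using fin[OF q(2)] q(1) unfolding supp_def by auto
    have "g x = (\<Sum>p\<in>insert q (supp x). F p (e p x))" using g_eq[OF A(1) _ A(2)] by blast
    then have "e q (g x) = (\<Sum>p\<in>insert q (supp x). e q (F p (e p x)))"
      by (simp only: endo_sum[OF e(1)[OF q(1)]])
    also have "\<dots> = (\<Sum>p\<in>insert q (supp x). if p = q then F q (e q x) else 0)"
    proof (rule sum.cong[OF refl])
      fix p assume "p \<in> insert q (supp x)"
      then have p: "prime p" using A by blast
      show "e q (F p (e p x)) = (if p = q then F q (e q x) else 0)"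
        using ortho[OF q(1) p _ Fin[OF p e(2)[OF p]]] e(3)[OF q(1) Fin[OF q(1) e(2)[OF q(1)]]] by auto
    qed
    also have "\<dots> = F q (e q x)" using A(1) by simp
    finally show ?thesis .
  qed
  ultimately show ?thesis by blast
qed

text \<open>Coordinates intertwine the glued g with every F p, so the single stationary index of g
  on T is valid for all the slowest endomorphisms and hence for all endomorphisms of all
  T_p.\<close>

lemma primary_uniform_bound:
  assumes G: "strongly_coHopfian (UNIV :: 'a::ab_group_add set)"
    and T: "strongly_coHopfian (torsion_subgroup :: 'a set)"
  obtains m where "\<And>p f. prime p \<Longrightarrow> endo_on (primary p :: 'a set) f \<Longrightarrow>
    (f ^^ m) ` primary p = (f ^^ Suc m) ` (primary p :: 'a set)"
proof -
  have "\<forall>p. \<exists>F. prime p \<longrightarrow> endo_on (primary p :: 'a set) F \<and>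
      (\<forall>n. (F ^^ n) ` primary p = (F ^^ Suc n) ` primary p \<longrightarrow>
           (\<forall>f. endo_on (primary p :: 'a set) f \<longrightarrow> (f ^^ n) ` primary p = (f ^^ Suc n) ` primary p))"
    (is "\<forall>p. \<exists>F. prime p \<longrightarrow> ?R p F")
  proof
    fix p :: int
    have "\<exists>F. ?R p F" if "prime p" using slowest_endo[OF primary_uniformly_coHopfian[OF G that]] .
    then show "\<exists>F. prime p \<longrightarrow> ?R p F" by (cases "prime p") auto
  qed
  then obtain F where F: "\<And>p. prime p \<Longrightarrow> endo_on (primary p :: 'a set) (F p)"
    "\<And>p n f. prime p \<Longrightarrow> (F p ^^ n) ` primary p = (F p ^^ Suc n) ` primary p \<Longrightarrow>
       endo_on (primary p :: 'a set) f \<Longrightarrow> (f ^^ n) ` primary p = (f ^^ Suc n) ` primary p"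
    by metis
  have "\<exists>e. prime p \<longrightarrow> endo e \<and> range e \<subseteq> (primary p :: 'a set) \<and> (\<forall>x\<in>primary p. e x = x)" for p
    using primary_projection[OF G, of p] by metis
  then obtain e where "\<And>p. prime p \<Longrightarrow> endo (e p) \<and> range (e p) \<subseteq> (primary p :: 'a set) \<and> (\<forall>x\<in>primary p. e p x = x)"
    by metis
  then have e: "\<And>p. prime p \<Longrightarrow> endo (e p)" "\<And>p x. prime p \<Longrightarrow> e p x \<in> (primary p :: 'a set)"
      "\<And>p x. prime p \<Longrightarrow> x \<in> primary p \<Longrightarrow> e p x = x" by blast+
  obtain g where g: "endo_on (torsion_subgroup :: 'a set) g"
    "\<And>p x. prime p \<Longrightarrow> x \<in> torsion_subgroup \<Longrightarrow> e p (g x) = F p (e p x)"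
    using glue_primary_endos[of e F, OF e F(1)] by blast
  obtain n where n: "(g ^^ n) ` torsion_subgroup = (g ^^ Suc n) ` (torsion_subgroup :: 'a set)"
    using T g(1) unfolding strongly_coHopfian_def by blast
  have gT: "(g ^^ j) x \<in> torsion_subgroup" if "x \<in> torsion_subgroup" for j x
    using endo_on_funpow[OF g(1), of j] that unfolding endo_on_def by blast
  have gF: "e p ((g ^^ j) x) = (F p ^^ j) (e p x)" if "prime p" "x \<in> torsion_subgroup" for p j x
    by (induction j) (use g(2) gT that in auto)
  have st: "(F p ^^ n) ` primary p = (F p ^^ Suc n) ` primary p" if p: "prime p" for p
  proof (rule funpow_image_eqI)
    show "F p ` primary p \<subseteq> primary p" using F(1)[OF p] unfolding endo_on_def by blast
    show "(F p ^^ n) ` primary p \<subseteq> (F p ^^ Suc n) ` primary p"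
    proof
      fix y assume "y \<in> (F p ^^ n) ` primary p"
      then obtain x where x: "x \<in> primary p" "y = (F p ^^ n) x" by blast
      then have xT: "x \<in> torsion_subgroup" using primary_subset_torsion[OF p] by blast
      then obtain z where z: "z \<in> torsion_subgroup" "(g ^^ n) x = (g ^^ Suc n) z" using n by blast
      have "y = e p ((g ^^ n) x)" using gF[OF p xT] e(3)[OF p x(1)] x(2) by simp
      also have "\<dots> = (F p ^^ Suc n) (e p z)" unfolding z(2) by (rule gF[OF p z(1)])
      finally show "y \<in> (F p ^^ Suc n) ` primary p" using e(2)[OF p] by blast
    qed
  qed
  show thesis by (rule that) (rule F(2)[OF _ st])
qed

section \<open>The group modulo its torsion subgroup\<close>

text \<open>X is a union of cosets of P, finitely many by \<open>F\<close>, and f induces a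
  surjection of X/P onto itself; on a finite set this is injective. The proof works with
  representatives: once the classes killed by f^j and by f^(j+1) agree, write x as f^j y modulo
  P.\<close>

lemma injective_mod_finite_index:
  fixes f :: "'a::ab_group_add \<Rightarrow> 'a"
  assumes f: "endo f" and P: "Z.subspace P" "f ` P \<subseteq> P"
    and F: "finite F" "\<And>x. \<exists>t\<in>F. x - t \<in> P"
    and X: "\<And>x q. x \<in> X \<Longrightarrow> q \<in> P \<Longrightarrow> x + q \<in> X" "f ` X \<subseteq> X"
      "\<And>x. x \<in> X \<Longrightarrow> \<exists>y\<in>X. x - f y \<in> P"
    and x: "x \<in> X" "(f ^^ i) x \<in> P"
  shows "x \<in> P"
proof -
  have fj: "endo (f ^^ j)" for j by (rule endo_on_funpow[OF f])
  have fP: "(f ^^ j) q \<in> P" if "q \<in> P" for j q using that P(2) by (induction j) auto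
  have iter: "\<exists>y\<in>X. x - (f ^^ j) y \<in> P" if "x \<in> X" for x j
  proof (induction j)
    case 0 then show ?case using that Z.subspace_0[OF P(1)] by (intro bexI[of _ x]) auto
  next
    case (Suc j)
    then obtain y where y: "y \<in> X" "x - (f ^^ j) y \<in> P" by blast
    then obtain z where z: "z \<in> X" "y - f z \<in> P" using X(3) by blast
    have "x - (f ^^ Suc j) z = (x - (f ^^ j) y) + (f ^^ j) (y - f z)"
      unfolding endo_diff[OF fj] by (simp add: funpow_swap1)
    then show ?case using Z.subspace_add[OF P(1) y(2) fP[OF z(2)]] z(1) by metis
  qed
  \<comment> \<open>The classes killed by f^j increase with j; their complement in F is taken so
    that \<open>decreasing_chain_stationary\<close> applies.\<close>
  define L where "L j = {t\<in>F. \<not> (t \<in> X \<and> (f ^^ j) t \<in> P)}" for j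
  have "L (Suc j) \<subseteq> L j" for j using P(2) unfolding L_def by auto
  moreover have "finite (L 0)" using F(1) unfolding L_def by simp
  ultimately obtain j where j: "L (Suc j) = L j" using decreasing_chain_stationary[of L] by blast
  have one: "x \<in> P" if xX: "x \<in> X" and fx: "f x \<in> P" for x
  proof -
    obtain y where y: "y \<in> X" "x - (f ^^ j) y \<in> P" using iter[OF xX] by blast
    obtain t where t: "t \<in> F" "y - t \<in> P" using F(2) by blast
    have tX: "t \<in> X" using X(1)[OF y(1) Z.subspace_neg[OF P(1) t(2)]] by simp
    have "x - (f ^^ j) t = (x - (f ^^ j) y) + (f ^^ j) (y - t)" unfolding endo_diff[OF fj] by simp
    then have xt: "x - (f ^^ j) t \<in> P" using Z.subspace_add[OF P(1) y(2) fP[OF t(2)]] by metis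
    have "(f ^^ Suc j) t = f x - f (x - (f ^^ j) t)" unfolding endo_diff[OF f] by simp
    then have "(f ^^ Suc j) t \<in> P" using Z.subspace_diff[OF P(1) fx] P(2) xt by auto
    then have "(f ^^ j) t \<in> P" using j t(1) tX unfolding L_def by blast
    from Z.subspace_add[OF P(1) xt this] show ?thesis by simp
  qed
  show ?thesis using x
  proof (induction i arbitrary: x)
    case (Suc i)
    then have "f x \<in> P" using X(2) by (auto simp: funpow_swap1)
    then show ?case using one Suc by blast
  qed simp
qed

text \<open>The first Ulm subgroup.\<close>
definition ulm :: "'a::ab_group_add set" where
  "ulm = {x. \<forall>p k. prime p \<longrightarrow> x \<in> multiples (p ^ k)}"

lemma subspace_ulm: "Z.subspace (ulm :: 'a::ab_group_add set)"
proof (rule subspaceI)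
  show "(0::'a) \<in> ulm" using Z.subspace_0[OF subspace_multiples[where 'a = 'a]] unfolding ulm_def by blast
  show "x + y \<in> ulm" if "x \<in> ulm" "y \<in> ulm" for x y :: 'a
    using that Z.subspace_add[OF subspace_multiples[where 'a = 'a]] unfolding ulm_def by blast
  show "- x \<in> ulm" if "x \<in> ulm" for x :: 'a
    using that Z.subspace_neg[OF subspace_multiples[where 'a = 'a]] unfolding ulm_def by blast
qed

lemma endo_multiples:
  assumes f: "endo f" and x: "x \<in> multiples k" shows "f x \<in> multiples k"
proof -
  obtain y where "x = k \<cdot> y" using x by blast
  then have "f x = k \<cdot> f y" using endo_zmult[OF f] by simp
  then show ?thesis by blast
qed

lemma multiples_stable_mem:
  assumes n: "\<And>k. n \<le> k \<Longrightarrow> multiples (p ^ k) = (multiples (p ^ n) :: 'a::ab_group_add set)"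
    and x: "(x::'a) \<in> multiples (p ^ n)"
  shows "x \<in> multiples (p ^ k)"
proof (cases "n \<le> k")
  case True
  show ?thesis using x unfolding n[OF True] .
next
  case False
  obtain y where y: "x = p ^ n \<cdot> y" using x by blast
  have "p ^ n = p ^ k * p ^ (n - k)" using False by (simp add: power_add[symmetric])
  then have "x = p ^ k \<cdot> p ^ (n - k) \<cdot> y" using y by simp
  then show ?thesis by blast
qed

lemma divisible_ulm:
  assumes G: "strongly_coHopfian (UNIV :: 'a::ab_group_add set)"
  shows "divisible (ulm :: 'a set)"
proof -
  have prime_div: "\<exists>y\<in>ulm. p \<cdot> y = x" if p: "prime p" and x: "x \<in> ulm" for p and x :: 'a
  proof -
    obtain n where n: "\<And>k. n \<le> k \<Longrightarrow> multiples (p ^ k) = (multiples (p ^ n) :: 'a set)"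
      using coHopfian_multiples_stable[OF G] by blast
    have "x \<in> multiples (p ^ Suc n)" using x p unfolding ulm_def by blast
    then obtain z where z: "x = p ^ Suc n \<cdot> z" by blast
    \<comment> \<open>By the choice of n, p^n G is contained in every p^k G, so y is divisible by
      all powers of p. For another prime q, y is a combination of p y = x and q^k y, hence inherits
      divisibility by q^k from x.\<close>
    define y where "y = p ^ n \<cdot> z"
    have py: "p \<cdot> y = x" unfolding y_def z by simp
    have "y \<in> multiples (q ^ k)" if q: "prime q" for q k
    proof (cases "q = p")
      case True
      then show ?thesis using multiples_stable_mem[OF n, of y k] unfolding y_def by blast
    next
      case False
      then have "coprime p (q ^ k)" using p q by (simp add: primes_coprime)
      then obtain c e where "y = c \<cdot> p \<cdot> y + e \<cdot> q ^ k \<cdot> y" using bezout_zmult by blast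
      then have yce: "y = c \<cdot> x + q ^ k \<cdot> e \<cdot> y" unfolding py by (simp add: mult.commute)
      have "x \<in> multiples (q ^ k)" using x q unfolding ulm_def by blast
      then have "c \<cdot> x + q ^ k \<cdot> e \<cdot> y \<in> multiples (q ^ k)"
        by (intro Z.subspace_add[OF subspace_multiples] Z.subspace_scale[OF subspace_multiples] rangeI)
      then show ?thesis using yce by simp
    qed
    then show ?thesis using py unfolding ulm_def by blast
  qed
  have nat_div: "\<exists>y\<in>ulm. int n \<cdot> y = x" if "n > 0" "x \<in> ulm" for n and x :: 'a
    using that
  proof (induction n arbitrary: x rule: less_induct)
    case (less n)
    show ?case
    proof (cases "n = 1")
      case True then show ?thesis using less by auto
    next
      case False
      then obtain p where p: "prime p" "p dvd n" using prime_factor_nat by blast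
      then obtain m where m: "n = p * m" by (auto simp: dvd_def)
      then have "m < n" "m > 0" using less(2) prime_gt_1_nat[OF p(1)] by auto
      then obtain y where y: "y \<in> ulm" "int m \<cdot> y = x" using less by blast
      obtain z where "z \<in> ulm" "int p \<cdot> z = y" using prime_div[of "int p" y] p y by auto
      then show ?thesis using y m by (intro bexI[of _ z]) (auto simp: mult.commute)
    qed
  qed
  show ?thesis unfolding divisible_def
  proof (intro allI impI)
    fix k :: int and u :: 'a assume k: "k \<noteq> 0" and u: "u \<in> ulm"
    have "sgn k \<cdot> u \<in> ulm" using Z.subspace_scale[OF subspace_ulm u] .
    then obtain y where y: "y \<in> ulm" "int (nat \<bar>k\<bar>) \<cdot> y = sgn k \<cdot> u"
      using nat_div[of "nat \<bar>k\<bar>"] k by auto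
    have "k \<cdot> y = sgn k \<cdot> int (nat \<bar>k\<bar>) \<cdot> y" by (simp add: sgn_mult_abs)
    also have "\<dots> = u" unfolding y(2) using k by (simp add: sgn_mult_self_eq)
    finally show "\<exists>v\<in>ulm. k \<cdot> v = u" using y(1) by blast
  qed
qed

text \<open>The index i of f gives g' such that f^i kills x = f^m g - f^(m+1) g'. In G/p^n G every
  class has a representative in T_p, so images are stationary from m on and f is injective on the
  m-th one. Hence x lies in p^n G.\<close>

lemma stable_mod_ulm:
  assumes G: "strongly_coHopfian (UNIV :: 'a::ab_group_add set)"
    and m: "\<And>p f. prime p \<Longrightarrow> endo_on (primary p :: 'a set) f \<Longrightarrow>
      (f ^^ m) ` primary p = (f ^^ Suc m) ` (primary p :: 'a set)"
    and f: "endo (f :: 'a \<Rightarrow> 'a)"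
  shows "\<exists>g'. (f ^^ m) g - (f ^^ Suc m) g' \<in> ulm"
proof -
  have fj: "endo (f ^^ j)" for j by (rule endo_on_funpow[OF f])
  obtain i where "(f ^^ i) ` UNIV = (f ^^ Suc i) ` UNIV"
    using G f unfolding strongly_coHopfian_def by blast
  then have "(f ^^ (i + m)) ` UNIV = (f ^^ Suc (i + m)) ` UNIV" by (rule funpow_image_eq_mono) simp
  \<comment> \<open>One g' is fixed before any prime is considered; choosing it separately for each
    p would not place x in \<open>ulm\<close>.\<close>
  then obtain g' where g': "(f ^^ (i + m)) g = (f ^^ Suc (i + m)) g'" by blast
  define x where "x = (f ^^ m) (g - f g')"
  have x: "x = (f ^^ m) g - (f ^^ Suc m) g'" unfolding x_def endo_diff[OF fj] by (simp add: funpow_swap1)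
  have "(f ^^ (i + Suc m)) g' = (f ^^ i) ((f ^^ Suc m) g')" by (simp only: funpow_add comp_apply)
  then have "(f ^^ i) x = 0" unfolding x endo_diff[OF fj] using g' by (simp add: funpow_add)
  have "x \<in> multiples (p ^ k)" if p: "prime p" for p k
  proof -
    obtain n where n: "\<And>k. n \<le> k \<Longrightarrow> multiples (p ^ k) = (multiples (p ^ n) :: 'a set)"
      using coHopfian_multiples_stable[OF G] by blast
    let ?P = "multiples (p ^ n) :: 'a set"
    note sP = subspace_multiples[of "p ^ n", where 'a = 'a]
    \<comment> \<open>The preimage in G of the m-th image of f in G/p^n G.\<close>
    define X where "X = {(f ^^ m) g + q | g q. q \<in> ?P}"
    have "x \<in> ?P"
    proof (rule injective_mod_finite_index[OF f sP _ _ _ _ _ _, where X = X and i = i])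
      show "f ` ?P \<subseteq> ?P" using endo_multiples[OF f] by blast
      show "finite {t::'a. p ^ n \<cdot> t = 0}" using finite_annihilator_power[OF finite_socle[OF G p]] .
      show "\<exists>t\<in>{t. p ^ n \<cdot> t = 0}. y - t \<in> ?P" for y
      proof -
        obtain t d where "y = t + d" "p ^ n \<cdot> t = 0" "d \<in> ?P" using annihilator_plus_multiples[OF n] by metis
        then show ?thesis by (intro bexI[of _ t]) auto
      qed
      show "y + q \<in> X" if "y \<in> X" "q \<in> ?P" for y q
      proof -
        obtain g q' where "y = (f ^^ m) g + q'" "q' \<in> ?P" using \<open>y \<in> X\<close> unfolding X_def by blast
        then have "y + q = (f ^^ m) g + (q' + q)" "q' + q \<in> ?P"
          using Z.subspace_add[OF sP _ \<open>q \<in> ?P\<close>] by (auto simp: add.assoc)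
        then show ?thesis unfolding X_def by blast
      qed
      show "f ` X \<subseteq> X"
      proof
        fix z assume "z \<in> f ` X"
        then obtain g q where "z = f ((f ^^ m) g + q)" "q \<in> ?P" unfolding X_def by blast
        then have "z = (f ^^ m) (f g) + f q" "f q \<in> ?P"
          using endo_add[OF f] endo_multiples[OF f] by (auto simp: funpow_swap1)
        then show "z \<in> X" unfolding X_def by blast
      qed
      show "\<exists>z\<in>X. y - f z \<in> ?P" if y: "y \<in> X" for y
      proof -
        obtain g q where gq: "y = (f ^^ m) g + q" "q \<in> ?P" using y unfolding X_def by blast
        obtain t d where td: "g = t + d" "p ^ n \<cdot> t = 0" "d \<in> ?P" using annihilator_plus_multiples[OF n] by metis
        have "t \<in> primary p" using td(2) unfolding primary_def by blast
        moreover have "endo_on (primary p) f" by (rule endo_on_primary[OF f Z.subspace_UNIV]) simp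
        ultimately obtain t' where t': "(f ^^ m) t = (f ^^ Suc m) t'" using m[OF p, of f] by blast
        have "y - f ((f ^^ m) t') = (f ^^ m) d + q"
          unfolding gq(1) td(1) endo_add[OF fj] t' by simp
        moreover have "(f ^^ m) d + q \<in> ?P"
          using endo_multiples[OF fj td(3)] gq(2) by (rule Z.subspace_add[OF sP])
        moreover have "(f ^^ m) t' + 0 \<in> X" unfolding X_def using Z.subspace_0[OF sP] by blast
        ultimately show ?thesis by (metis add.right_neutral)
      qed
      have "(f ^^ m) (g - f g') + 0 \<in> X" unfolding X_def using Z.subspace_0[OF sP] by blast
      then show "x \<in> X" unfolding x_def by simp
      show "(f ^^ i) x \<in> ?P" using \<open>(f ^^ i) x = 0\<close> Z.subspace_0[OF sP] by simp
    qed
    then show ?thesis by (rule multiples_stable_mem[rotated]) (rule n)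
  qed
  then have "x \<in> ulm" unfolding ulm_def by blast
  then show ?thesis unfolding x by blast
qed

section \<open>Torsion-free rank and the final bound\<close>

text \<open>Gaussian elimination without division: with a pivot row r in column j, the rows A_rj A_i
  - A_ij A_r vanish in column j, and the induction hypothesis applies to the remaining
  columns.\<close>

lemma int_linear_dependence:
  fixes A :: "'i \<Rightarrow> 'j \<Rightarrow> int"
  assumes "finite J" "finite I" "card J < card I"
  shows "\<exists>c. (\<exists>i\<in>I. c i \<noteq> 0) \<and> (\<forall>j\<in>J. (\<Sum>i\<in>I. c i * A i j) = 0)"
  using assms
proof (induction J arbitrary: I A rule: finite_induct)
  case empty
  then have "I \<noteq> {}" by auto
  then show ?case by (intro exI[of _ "\<lambda>_. 1"]) auto
next
  case (insert j J)
  show ?case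
  proof (cases "\<forall>i\<in>I. A i j = 0")
    case True
    have "card J < card I" using insert by simp
    then obtain c where "\<exists>i\<in>I. c i \<noteq> 0" "\<forall>j\<in>J. (\<Sum>i\<in>I. c i * A i j) = 0"
      using insert.IH[OF insert.prems(1)] by blast
    then show ?thesis using True by (intro exI[of _ c]) auto
  next
    case False
    then obtain r where r: "r \<in> I" "A r j \<noteq> 0" by blast
    let ?I = "I - {r}"
    have "finite ?I" "card J < card ?I" using insert r by auto
    from insert.IH[OF this, of "\<lambda>i l. A r j * A i l - A i j * A r l"]
    obtain c where c: "\<exists>i\<in>?I. c i \<noteq> 0"
      "\<forall>l\<in>J. (\<Sum>i\<in>?I. c i * (A r j * A i l - A i j * A r l)) = 0" by blast
    \<comment> \<open>The coefficient at r collects the multiples of the pivot row subtracted from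
      the other rows.\<close>
    define b where "b i = (if i = r then - (\<Sum>i\<in>?I. c i * A i j) else A r j * c i)" for i
    have sum_b: "(\<Sum>i\<in>I. b i * A i l) = (\<Sum>i\<in>?I. c i * (A r j * A i l - A i j * A r l))" for l
    proof -
      have "(\<Sum>i\<in>I. b i * A i l) = b r * A r l + (\<Sum>i\<in>?I. b i * A i l)"
        using insert.prems(1) r(1) by (rule sum.remove)
      also have "(\<Sum>i\<in>?I. b i * A i l) = (\<Sum>i\<in>?I. A r j * c i * A i l)"
        by (rule sum.cong) (auto simp: b_def)
      also have "b r * A r l = - (\<Sum>i\<in>?I. c i * A i j * A r l)"
        unfolding b_def by (simp add: sum_distrib_right)
      finally show ?thesis by (simp add: sum_subtractf algebra_simps)
    qed
    have "(\<Sum>i\<in>I. b i * A i l) = 0" if "l \<in> insert j J" for l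
    proof (cases "l = j")
      case True
      then show ?thesis unfolding sum_b by (simp add: mult.commute)
    next
      case False
      then show ?thesis unfolding sum_b using c(2) that by blast
    qed
    moreover obtain i where "i \<in> I" "i \<noteq> r" "c i \<noteq> 0" using c(1) by blast
    then have "\<exists>i\<in>I. b i \<noteq> 0" using r(2) by (intro bexI[of _ i]) (auto simp: b_def)
    ultimately show ?thesis by blast
  qed
qed

text \<open>If no finite list worked, each next \<open>w n\<close> could be chosen in U with no
  nonzero multiple in the span of its predecessors. This is an independent sequence of elements of
  infinite order, the case d = 0 of the shift argument.\<close>

lemma divisible_finite_rank:
  assumes G: "strongly_coHopfian (UNIV :: 'a::ab_group_add set)"
    and U: "Z.subspace (U :: 'a set)" "divisible U"
  shows "\<exists>w N. \<forall>x\<in>U. \<exists>b a. b \<noteq> 0 \<and> b \<cdot> x = lin w a N"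
proof (rule ccontr)
  assume c: "\<not> ?thesis"
  have "\<exists>w. \<forall>n. w n \<in> U \<and> (\<forall>b a. b \<noteq> 0 \<longrightarrow> b \<cdot> w n \<noteq> lin w a n)"
  proof (rule dependent_wellorder_choice)
    fix r and f g :: "nat \<Rightarrow> 'a" and n :: nat assume "\<And>y. y < n \<Longrightarrow> f y = g y"
    then have "lin f a n = lin g a n" for a unfolding lin_def by simp
    then show "(r \<in> U \<and> (\<forall>b a. b \<noteq> 0 \<longrightarrow> b \<cdot> r \<noteq> lin f a n)) =
        (r \<in> U \<and> (\<forall>b a. b \<noteq> 0 \<longrightarrow> b \<cdot> r \<noteq> lin g a n))" by simp
  qed (use c in blast)
  then obtain w where w: "\<And>n. w n \<in> U" "\<And>n b a. b \<noteq> 0 \<Longrightarrow> b \<cdot> w n \<noteq> lin w a n" by blast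
  have "\<forall>i<n. a i = 0" if "lin w a n = 0" for a n
    using that
  proof (induction n)
    case (Suc n)
    have "a n \<cdot> w n = lin w (\<lambda>i. - a i) n"
      using Suc.prems unfolding lin_Suc lin_minus[symmetric] by (metis eq_neg_iff_add_eq_0 add.commute)
    then have "a n = 0" using w(2) by blast
    then show ?case using Suc by (auto simp: lin_Suc less_Suc_eq)
  qed simp
  then have "indep_seq 0 w" by (intro indep_seqI) auto
  then show False using no_indep_seq_in_divisible[OF G U, of w 0] w(1) by simp
qed

text \<open>The N + 1 elements x, f x, ..., f^N x satisfy a nontrivial integer relation. If d_j is
  its lowest nonzero coefficient, then d_j f^j x is an image under f^(j+1), and divisibility of U
  removes the factor d_j up to torsion.\<close>

lemma finite_rank_stable_mod_torsion:
  fixes f :: "'a::ab_group_add \<Rightarrow> 'a"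
  assumes U: "Z.subspace U" "divisible U" and w: "\<forall>x\<in>U. \<exists>b a. b \<noteq> 0 \<and> b \<cdot> x = lin w a N"
    and f: "endo f" "f ` U \<subseteq> U" and x: "x \<in> U"
  shows "\<exists>y\<in>U. (f ^^ N) x - (f ^^ Suc N) y \<in> torsion_subgroup"
proof -
  have fj: "endo (f ^^ j)" for j by (rule endo_on_funpow[OF f(1)])
  have fU: "(f ^^ j) u \<in> U" if "u \<in> U" for j u using that f(2) by (induction j) auto
  have "\<forall>i. \<exists>b a. b \<noteq> 0 \<and> b \<cdot> (f ^^ i) x = lin w a N" using w fU[OF x] by simp
  then obtain b A where "\<forall>i. b i \<noteq> 0 \<and> b i \<cdot> (f ^^ i) x = lin w (A i) N"
    unfolding choice_iff by blast
  then have bA: "\<And>i. b i \<noteq> 0" "\<And>i. b i \<cdot> (f ^^ i) x = lin w (A i) N" by simp_all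
  have "card {..<N} < card {..N}" by simp
  then have "\<exists>c. (\<exists>i\<in>{..N}. c i \<noteq> 0) \<and> (\<forall>j\<in>{..<N}. (\<Sum>i\<in>{..N}. c i * A i j) = 0)"
    by (rule int_linear_dependence[OF finite_lessThan finite_atMost])
  then obtain c where c: "\<exists>i\<in>{..N}. c i \<noteq> 0" "\<forall>j\<in>{..<N}. (\<Sum>i\<in>{..N}. c i * A i j) = 0"
    by (elim exE conjE)
  define d where "d i = c i * b i" for i
  have "(\<Sum>i\<le>N. d i \<cdot> (f ^^ i) x) = (\<Sum>i\<le>N. c i \<cdot> lin w (A i) N)"
    unfolding d_def bA(2)[symmetric] by simp
  also have "\<dots> = (\<Sum>i\<le>N. \<Sum>j<N. (c i * A i j) \<cdot> w j)"
    unfolding lin_def by (simp add: Z.scale_sum_right)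
  also have "\<dots> = (\<Sum>j<N. (\<Sum>i\<le>N. c i * A i j) \<cdot> w j)"
    unfolding Z.scale_sum_left by (rule sum.swap)
  also have "\<dots> = 0" using c(2) by simp
  finally have rel: "(\<Sum>i\<le>N. d i \<cdot> (f ^^ i) x) = 0" .
  define j where "j = (LEAST i. d i \<noteq> 0)"
  obtain i0 where i0: "i0 \<le> N" "d i0 \<noteq> 0" using c(1) bA(1) unfolding d_def by auto
  have dj: "d j \<noteq> 0" unfolding j_def using i0(2) by (rule LeastI)
  have jN: "j \<le> N" unfolding j_def using Least_le[of "\<lambda>i. d i \<noteq> 0", OF i0(2)] i0(1) by simp
  have dlt: "d i = 0" if "i < j" for i using not_less_Least that unfolding j_def by blast
  define y where "y = (\<Sum>i\<in>{Suc j..N}. d i \<cdot> (f ^^ (i - Suc j)) x)"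
  have yU: "y \<in> U" unfolding y_def
    by (intro Z.subspace_sum[OF U(1)] Z.subspace_scale[OF U(1)] fU[OF x])
  have fy: "(f ^^ Suc j) y = (\<Sum>i\<in>{Suc j..N}. d i \<cdot> (f ^^ i) x)"
    unfolding y_def endo_sum[OF fj]
  proof (rule sum.cong[OF refl])
    fix i assume i: "i \<in> {Suc j..N}"
    then have "(f ^^ i) x = (f ^^ Suc j) ((f ^^ (i - Suc j)) x)"
      using funpow_add[of "Suc j" "i - Suc j" f] by (simp del: funpow.simps)
    then show "(f ^^ Suc j) (d i \<cdot> (f ^^ (i - Suc j)) x) = d i \<cdot> (f ^^ i) x"
      unfolding endo_zmult[OF fj] by simp
  qed
  have "(\<Sum>i\<le>N. d i \<cdot> (f ^^ i) x) = (\<Sum>i\<in>{j..N}. d i \<cdot> (f ^^ i) x)"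
    using dlt by (intro sum.mono_neutral_right) auto
  also have "\<dots> = d j \<cdot> (f ^^ j) x + (f ^^ Suc j) y"
    unfolding fy using jN by (rule sum.atLeast_Suc_atMost)
  finally have rel2: "d j \<cdot> (f ^^ j) x + (f ^^ Suc j) y = 0" using rel by simp
  obtain z where z: "z \<in> U" "d j \<cdot> z = - y"
    using U(2) dj Z.subspace_neg[OF U(1) yU] unfolding divisible_def by blast
  have "d j \<cdot> ((f ^^ j) x - (f ^^ Suc j) z) = d j \<cdot> (f ^^ j) x - (f ^^ Suc j) (d j \<cdot> z)"
    unfolding endo_zmult[OF fj] by (rule Z.scale_right_diff_distrib)
  also have "\<dots> = 0" unfolding z(2) endo_minus[OF fj] using rel2 by simp
  finally have "(f ^^ j) x - (f ^^ Suc j) z \<in> torsion_subgroup" using dj unfolding torsion_iff by blast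
  \<comment> \<open>The index j depends on x; applying f^(N-j) replaces it by the common index
    N.\<close>
  then have "(f ^^ (N - j)) ((f ^^ j) x - (f ^^ Suc j) z) \<in> torsion_subgroup"
    using endo_on_torsion[OF fj] unfolding endo_on_def by blast
  moreover have "(f ^^ (N - j)) ((f ^^ i) u) = (f ^^ (N - j + i)) u" for i u by (simp add: funpow_add)
  ultimately have "(f ^^ N) x - (f ^^ Suc N) z \<in> torsion_subgroup"
    unfolding endo_diff[OF fj] using jN by (simp del: funpow.simps)
  then show ?thesis using z(1) by blast
qed

text \<open>Two uses of \<open>extension_stable\<close> along T, B = U + T and G. In
  \<open>m + N + m\<close> the first m belongs to T, N to B/T and the last m to G/B, where
  stationarity modulo U is inherited.\<close>

lemma uniform_if_torsion_coHopfian: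
  assumes G: "strongly_coHopfian (UNIV :: 'a::ab_group_add set)"
    and T: "strongly_coHopfian (torsion_subgroup :: 'a set)"
  shows "uniformly_strongly_coHopfian (UNIV :: 'a set)"
proof -
  obtain m where m: "\<And>p f. prime p \<Longrightarrow> endo_on (primary p :: 'a set) f \<Longrightarrow>
      (f ^^ m) ` primary p = (f ^^ Suc m) ` (primary p :: 'a set)"
    using primary_uniform_bound[OF G T] by blast
  obtain w N where w: "\<forall>x\<in>ulm. \<exists>b a. b \<noteq> 0 \<and> b \<cdot> (x::'a) = lin w a N"
    using divisible_finite_rank[OF G subspace_ulm divisible_ulm[OF G]] by blast
  define B :: "'a set" where "B = {u + t | u t. u \<in> ulm \<and> t \<in> torsion_subgroup}"
  have B: "Z.subspace B"
  proof (rule subspaceI)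
    have "0 + 0 \<in> B" unfolding B_def using Z.subspace_0[OF subspace_ulm] Z.subspace_0[OF subspace_torsion] by blast
    then show "0 \<in> B" by simp
  next
    fix x y assume "x \<in> B" "y \<in> B"
    then obtain u t u' t' where *: "x = u + t" "y = u' + t'" "u \<in> ulm" "t \<in> torsion_subgroup"
      "u' \<in> ulm" "t' \<in> torsion_subgroup" unfolding B_def by blast
    then have "x + y = (u + u') + (t + t')" by (simp add: algebra_simps)
    then show "x + y \<in> B" unfolding B_def
      using Z.subspace_add[OF subspace_ulm *(3,5)] Z.subspace_add[OF subspace_torsion *(4,6)] by blast
  next
    fix x assume "x \<in> B"
    then obtain u t where *: "x = u + t" "u \<in> ulm" "t \<in> torsion_subgroup" unfolding B_def by blast
    then have "- x = - u + - t" by simp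
    then show "- x \<in> B" unfolding B_def
      using Z.subspace_neg[OF subspace_ulm *(2)] Z.subspace_neg[OF subspace_torsion *(3)] by blast
  qed
  have TB: "torsion_subgroup \<subseteq> B" unfolding B_def using Z.subspace_0[OF subspace_ulm] by force
  have UB: "ulm \<subseteq> B" unfolding B_def using Z.subspace_0[OF subspace_torsion] by force
  have "(f ^^ (m + N + m)) ` UNIV = (f ^^ Suc (m + N + m)) ` UNIV" if f: "endo f" for f :: "'a \<Rightarrow> 'a"
  proof (rule extension_stable[OF f Z.subspace_UNIV subset_UNIV])
    have fj: "endo (f ^^ j)" for j by (rule endo_on_funpow[OF f])
    show "\<exists>a'\<in>UNIV. (f ^^ m) a - (f ^^ Suc m) a' \<in> B" for a
      using stable_mod_ulm[OF G m f] UB by blast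
    have fU: "f ` ulm \<subseteq> ulm" using endo_multiples[OF f] unfolding ulm_def by blast
    note fT = endo_on_torsion[OF f]
    have fB: "endo_on B f"
      unfolding endo_on_def
    proof (intro conjI ballI subsetI)
      fix y assume "y \<in> f ` B"
      then obtain u t where "y = f u + f t" "u \<in> ulm" "t \<in> torsion_subgroup"
        unfolding B_def using endo_add[OF f] by auto
      then show "y \<in> B" unfolding B_def using fU fT unfolding endo_on_def by blast
    qed (rule endo_add[OF f])
    have "endo_on (primary p) f" for p by (rule endo_on_primary[OF f Z.subspace_UNIV]) simp
    then have "(f ^^ m) ` torsion_subgroup = (f ^^ Suc m) ` torsion_subgroup"
      by (intro torsion_stable_of_primary[OF fT] m)
    then show "(f ^^ (m + N)) ` B = (f ^^ Suc (m + N)) ` B"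
    proof (rule extension_stable[OF fB B TB, rotated])
      fix a assume "a \<in> B"
      then obtain u t where ut: "a = u + t" "u \<in> ulm" "t \<in> torsion_subgroup" unfolding B_def by blast
      obtain y where y: "y \<in> ulm" "(f ^^ N) u - (f ^^ Suc N) y \<in> torsion_subgroup"
        using finite_rank_stable_mod_torsion[OF subspace_ulm divisible_ulm[OF G] w f fU ut(2)] by blast
      have "(f ^^ N) t \<in> torsion_subgroup" using endo_on_torsion[OF fj] ut(3) unfolding endo_on_def by blast
      moreover have "(f ^^ N) a - (f ^^ Suc N) y = ((f ^^ N) u - (f ^^ Suc N) y) + (f ^^ N) t"
        unfolding ut(1) endo_add[OF fj] by simp
      ultimately have "(f ^^ N) a - (f ^^ Suc N) y \<in> torsion_subgroup"
        using Z.subspace_add[OF subspace_torsion y(2)] by metis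
      then show "\<exists>a'\<in>B. (f ^^ N) a - (f ^^ Suc N) a' \<in> torsion_subgroup" using y(1) UB by blast
    qed
  qed
  then show ?thesis unfolding uniformly_strongly_coHopfian_def by blast
qed

theorem mainTheorem12:
  assumes "strongly_coHopfian (UNIV :: 'a::ab_group_add set)"
  shows "uniformly_strongly_coHopfian (UNIV :: 'a set) \<longleftrightarrow>
         strongly_coHopfian (torsion_subgroup :: 'a set)"
  using torsion_coHopfian_if_uniform[OF assms] uniform_if_torsion_coHopfian[OF assms] by blast

end
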